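(* Let $n\ge3$ be an integer. There is the partition (union of pairwise disjoint sets) $$[\epsilon_{3,n},1)=\bigcup_{k=2}^\infty\mathscr I_{-k,1}.$$ Furthermore, for each $k\ge2$ and each $v\in\mathcal V$, the following is a partition: $$\mathscr I_{-k,v}=\mathscr J_{-k,v}\cup\bigcup_{q=q'}^\infty\mathscr I_{-k,\Theta_q(v)},$$ where $q'=0$ unless $v=c_1$ is a word of a single letter, in which case $q'=-1$; when $v=1$ the (undefined) term $q=0$ is omitted.
   Context: Let $n\ge 3$ and $t=1+2\cos(\pi/n)$. Put $A=\begin{pmatrix}1&t\\0&1\end{pmatrix}$, $C=\begin{pmatrix}-1&1\\-1&0\end{pmatrix}$, acting on $\mathbb R\cup\{\infty\}$ by Möbius transformations. For $\alpha\in[0,1]$ let $\mathbb I_\alpha=[(\alpha-1)t,\alpha t)$, and define $T_\alpha=T_{3,n,\alpha}$ on $[(\alpha-1)t,\alpha t]$ by $T_\alpha(x)=A^kC^l\cdot x$, where $l\ge1$ is minimal with $C^l\cdot x\notin\mathbb I_\alpha$ and $k=-\lfloor (C^l\cdot x)/t+1-\alpha\rfloor$. The pair $(k,l)$ is the $\alpha$-digit of $x$ (undefined, and the orbit stops, if $C^l\cdot x=\infty$). Let $\ell_0(\alpha)=(\alpha-1)t$, $r_0(\alpha)=\alpha t$. The digit sequence of $\ell_0(\alpha)$ is the sequence of $\alpha$-digits of $\ell_0(\alpha),T_\alpha(\ell_0(\alpha)),T_\alpha^2(\ell_0(\alpha)),\dots$; when a digit is $(k,1)$ it is abbreviated to the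 simplified digit $k$. The number $\epsilon_{3,n}\in(0,1)$ is the value of $\alpha$ with $A^{-1}C\cdot\ell_0(\alpha)=r_0(\alpha)$. Words. A word is a finite sequence $v=c_1d_1c_2d_2\cdots d_{s-1}c_s$ of positive integers, $s\ge1$. Put $v'=1(c_1-1)d_1c_2\cdots d_{s-1}c_s$ if $c_1\ne1$ and $v'=(d_1+1)c_2\cdots d_{s-1}c_s$ if $c_1=1$, $s>1$; in particular $v'=1(c-1)$ for $v=c>1$, and $v'=1$ for $v=1$. Define $\Theta_{-1}(c)=c+1$ for single-letter words $c\ge1$; $\Theta_q(1)=1q1$ for $q\ge1$ ($\Theta_0(1)$ is undefined); $\Theta_q(c)=c[1(c-1)]^q1c$ for $c>1$, $q\ge0$; and recursively, if $v=\Theta_p(u)=uv''$ for some $p\ge0$ and suffix $v''$, then $\Theta_q(v)=v(v')^qv''$ for $q\ge0$. $\mathcal V$ is the set of all words obtainable from the word $1$ by finite sequences of applications of the operators $\Theta_q$. Intervals. For $k\in\mathbb N$ and $v=c_1d_1\cdots d_{s-1}c_s$ let $\underline d(-k,v)=(-k)^{c_1},(-k-1)^{d_1},\dots,(-k-1)^{d_{s-1}},(-k)^{c_s}$ (exponents denote repetition). $\mathscr I_{-k,v}$ is the set of all $\alpha$ such that the digit sequence of $\ell_0(\alpha)$, in simplified digits, begins with $\underline d(-k,v)$ (all these digits having $l=1$). Let $L_{-k,v}=(A^{-k}C)^{c_s}(A^{-k-1}C)^{d_{s-1}}(A^{-k}C)^{c_{s-1}}\cdots(A^{-k-1}C)^{d_1}(A^{-k}C)^{c_1}A^{-1}$,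 and $\mathscr J_{-k,v}=[\eta_{-k,v},\zeta_{-k,v})$ where $\eta=\eta_{-k,v}$, $\zeta=\zeta_{-k,v}\in[0,1]$ are the parameters with $L_{-k,v}A\cdot\ell_0(\zeta)=r_0(\zeta)$ and $CA^{-1}CL_{-k,v}\cdot r_0(\eta)=C^{-1}\cdot\ell_0(\eta)$. *)

theory Defs
  imports "HOL-Analysis.Analysis"
begin

text \<open>The projective line \<open>\<real> \<union> {\<infinity>}\<close> is represented by \<^typ>\<open>real option\<close>,
  with \<^term>\<open>None\<close> as the point at infinity.\<close>

definition moebius_act :: "real^2^2 \<Rightarrow> real option \<Rightarrow> real option" where
  "moebius_act M z =
     (case z of
        None \<Rightarrow> if M$2$1 = 0 then None else Some (M$1$1 / M$2$1)
      | Some x \<Rightarrow> if M$2$1 * x + M$2$2 = 0 then None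
                  else Some ((M$1$1 * x + M$1$2) / (M$2$1 * x + M$2$2)))"

text \<open>The class instance of \<open>^\<close> for \<^typ>\<open>real^2^2\<close> is the componentwise power,
  so powers with respect to the matrix product are defined here.\<close>

definition mat_power :: "real^2^2 \<Rightarrow> nat \<Rightarrow> real^2^2" where
  "mat_power M k = (((**) M) ^^ k) (mat 1)"

definition mat_int_power :: "real^2^2 \<Rightarrow> int \<Rightarrow> real^2^2" where
  "mat_int_power M k =
     (if k \<ge> 0 then mat_power M (nat k) else mat_power (matrix_inv M) (nat (- k)))"

definition tpar :: "nat \<Rightarrow> real" where
  "tpar n = 1 + 2 * cos (pi / real n)"

definition matA :: "nat \<Rightarrow> real^2^2" where
  "matA n = vector [vector [1, tpar n], vector [0, 1]]"

definition matC :: "real^2^2" where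
  "matC = vector [vector [-1, 1], vector [-1, 0]]"

definition ell0 :: "nat \<Rightarrow> real \<Rightarrow> real" where
  "ell0 n \<alpha> = (\<alpha> - 1) * tpar n"

definition r0 :: "nat \<Rightarrow> real \<Rightarrow> real" where
  "r0 n \<alpha> = \<alpha> * tpar n"

definition dom_int :: "nat \<Rightarrow> real \<Rightarrow> real set" where
  "dom_int n \<alpha> = {ell0 n \<alpha>..<r0 n \<alpha>}"

definition digit_l :: "nat \<Rightarrow> real \<Rightarrow> real \<Rightarrow> nat" where
  "digit_l n \<alpha> x =
     (LEAST l. l \<ge> 1 \<and> moebius_act (mat_power matC l) (Some x) \<notin> Some ` dom_int n \<alpha>)"

definition digit :: "nat \<Rightarrow> real \<Rightarrow> real \<Rightarrow> (int \<times> nat) option" where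
  "digit n \<alpha> x =
     (case moebius_act (mat_power matC (digit_l n \<alpha> x)) (Some x) of
        None \<Rightarrow> None
      | Some y \<Rightarrow> Some (- \<lfloor>y / tpar n + 1 - \<alpha>\<rfloor>, digit_l n \<alpha> x))"

definition Tmap :: "nat \<Rightarrow> real \<Rightarrow> real \<Rightarrow> real option" where
  "Tmap n \<alpha> x =
     (case digit n \<alpha> x of
        None \<Rightarrow> None
      | Some (k, l) \<Rightarrow> moebius_act (mat_int_power (matA n) k ** mat_power matC l) (Some x))"

text \<open>Orbits and digit sequences are \<^term>\<open>None\<close> from the moment the orbit stops.\<close>

primrec orbit :: "nat \<Rightarrow> real \<Rightarrow> real \<Rightarrow> nat \<Rightarrow> real option" where
  "orbit n \<alpha> x 0 = Some x"
| "orbit n \<alpha> x (Suc i) = Option.bind (orbit n \<alpha> x i) (Tmap n \<alpha>)"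

definition digit_seq :: "nat \<Rightarrow> real \<Rightarrow> real \<Rightarrow> nat \<Rightarrow> (int \<times> nat) option" where
  "digit_seq n \<alpha> x i = Option.bind (orbit n \<alpha> x i) (digit n \<alpha>)"

definition eps :: "nat \<Rightarrow> real" where
  "eps n = (THE \<alpha>. 0 < \<alpha> \<and> \<alpha> < 1 \<and>
     moebius_act (mat_int_power (matA n) (-1) ** matC) (Some (ell0 n \<alpha>)) = Some (r0 n \<alpha>))"

text \<open>A word \<open>c\<^sub>1 d\<^sub>1 c\<^sub>2 \<dots> d\<^bsub>s-1\<^esub> c\<^sub>s\<close> is the list of its letters (of odd length, with positive
  entries). The value at the empty list is irrelevant.\<close>

fun word_prime :: "nat list \<Rightarrow> nat list" where
  "word_prime [] = []"
| "word_prime (c # w) =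
     (if c \<noteq> 1 then 1 # (c - 1) # w
      else (case w of [] \<Rightarrow> [1] | d # w' \<Rightarrow> (d + 1) # w'))"

definition word_power :: "nat list \<Rightarrow> nat \<Rightarrow> nat list" where
  "word_power w q = concat (replicate q w)"

text \<open>\<open>Theta_graph q v w\<close> is the relation \<open>\<Theta>\<^sub>q(v) = w\<close>. In rule \<open>step\<close> the word
  \<open>v = u s\<close> is itself an image \<open>\<Theta>\<^sub>p(u)\<close> with \<open>p \<ge> 0\<close>, and \<open>s\<close> is the suffix \<open>v''\<close>.\<close>

inductive Theta_graph :: "int \<Rightarrow> nat list \<Rightarrow> nat list \<Rightarrow> bool" where
  minus_one: "c \<ge> 1 \<Longrightarrow> Theta_graph (-1) [c] [c + 1]"
| one: "q \<ge> 1 \<Longrightarrow> Theta_graph (int q) [1] [1, q, 1]"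
| letter: "c > 1 \<Longrightarrow> Theta_graph (int q) [c] ([c] @ word_power [1, c - 1] q @ [1, c])"
| step: "Theta_graph (int p) u v \<Longrightarrow> v = u @ s \<Longrightarrow>
     Theta_graph (int q) v (v @ word_power (word_prime v) q @ s)"

definition Theta :: "int \<Rightarrow> nat list \<Rightarrow> nat list" where
  "Theta q v = (THE w. Theta_graph q v w)"

definition Theta_index :: "nat list \<Rightarrow> int set" where
  "Theta_index v = {(if length v = 1 then -1 else 0)..} - (if v = [1] then {0} else {})"

inductive_set Vwords :: "nat list set" where
  "[1] \<in> Vwords"
| "v \<in> Vwords \<Longrightarrow> Theta_graph q v w \<Longrightarrow> w \<in> Vwords"

fun d_lower :: "nat \<Rightarrow> nat list \<Rightarrow> int list" where
  "d_lower k [] = []"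
| "d_lower k [c] = replicate c (- int k)"
| "d_lower k (c # d # w) =
     replicate c (- int k) @ replicate d (- int k - 1) @ d_lower k w"

definition I_cyl :: "nat \<Rightarrow> nat \<Rightarrow> nat list \<Rightarrow> real set" where
  "I_cyl n k v = {\<alpha>. 0 \<le> \<alpha> \<and> \<alpha> \<le> 1 \<and>
     (\<forall>i < length (d_lower k v). digit_seq n \<alpha> (ell0 n \<alpha>) i = Some (d_lower k v ! i, 1))}"

text \<open>The matrix \<open>L\<^bsub>-k,v\<^esub> A\<close>; later letters of the word act further to the left.\<close>

fun LA_mat :: "nat \<Rightarrow> nat \<Rightarrow> nat list \<Rightarrow> real^2^2" where
  "LA_mat n k [] = mat 1"
| "LA_mat n k [c] = mat_power (mat_int_power (matA n) (- int k) ** matC) c"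
| "LA_mat n k (c # d # w) =
     LA_mat n k w ** mat_power (mat_int_power (matA n) (- int k - 1) ** matC) d
       ** mat_power (mat_int_power (matA n) (- int k) ** matC) c"

definition L_mat :: "nat \<Rightarrow> nat \<Rightarrow> nat list \<Rightarrow> real^2^2" where
  "L_mat n k v = LA_mat n k v ** matrix_inv (matA n)"

definition zeta :: "nat \<Rightarrow> nat \<Rightarrow> nat list \<Rightarrow> real" where
  "zeta n k v = (THE \<alpha>. 0 \<le> \<alpha> \<and> \<alpha> \<le> 1 \<and>
     moebius_act (L_mat n k v ** matA n) (Some (ell0 n \<alpha>)) = Some (r0 n \<alpha>))"

definition eta :: "nat \<Rightarrow> nat \<Rightarrow> nat list \<Rightarrow> real" where
  "eta n k v = (THE \<alpha>. 0 \<le> \<alpha> \<and> \<alpha> \<le> 1 \<and>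
     moebius_act (matC ** matrix_inv (matA n) ** matC ** L_mat n k v) (Some (r0 n \<alpha>))
       = moebius_act (matrix_inv matC) (Some (ell0 n \<alpha>)))"

definition J_int :: "nat \<Rightarrow> nat \<Rightarrow> nat list \<Rightarrow> real set" where
  "J_int n k v = {eta n k v..<zeta n k v}"

end

theory Submission
  imports Defs "HOL-Library.Sublist"
begin

text \<open>
  Put \<open>\<beta> = (1 - \<alpha>) t\<close>, so that \<open>\<ell>\<^sub>0 = -\<beta>\<close> and \<open>r\<^sub>0 = t - \<beta>\<close>, and use the coordinate \<open>y = -x\<close>. A digit
  \<open>(-j, 1)\<close> with \<open>j \<ge> 2\<close> means that \<open>(j t - 1) - 1 / y\<close> lies in \<open>(\<beta> - t, \<beta>]\<close>, and this number is then the next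
  point of the orbit. The inverse branches \<open>y \<mapsto> 1 / ((j t - 1) - y)\<close> are increasing contractions on the half-line
  \<open>y < 1\<close>. A parameter lies in \<open>\<I>\<^bsub>-k,v\<^esub>\<close> iff \<open>\<beta>\<close> is the image of some \<open>y\<close> under the inverse branches
  of the word and all later points of the orbit, down to \<open>y\<close>, lie in \<open>(\<beta> - t, \<beta>]\<close>.

  The words of \<open>\<V>\<close>, written out in the digits \<open>a = -k\<close> and \<open>b = -k-1\<close>, are the words
  \<open>w = U P a\<close> for the nodes \<open>(U, P)\<close> of a tree. The word \<open>v'\<close> becomes \<open>w' = P b U\<close>, which is \<open>w\<close> with its first
  digit raised, and the words \<open>\<Theta>\<^sub>q(v)\<close> become the words \<open>w w'\<^sup>m P a\<close> with \<open>m \<ge> 0\<close>, each once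
  (\<open>enc_Theta\<close>, \<open>child_index_bij\<close>).

  By \<open>cyl_node_iff\<close> the conditions on the later points of the orbit reduce to one, namely that \<open>y\<close> is at
  most its image under the inverse branches of \<open>P a\<close>. Now compare \<open>y\<close> with its image under the inverse
  branches of \<open>w'\<close>. If \<open>y\<close> is larger, its orbit runs through \<open>w'\<close> some \<open>m\<close> times; it has to leave since the
  branches expand, and the condition just mentioned permits it to leave by \<open>P a\<close> only. So the parameter lies in
  exactly one of the intervals of the words \<open>\<Theta>\<^sub>q(v)\<close> (\<open>cyl_partition\<close>, \<open>children_disjoint\<close>). If \<open>y\<close> is not
  larger, no such word follows (\<open>sync_not_child\<close>). In terms of \<open>\<beta>\<close> this last case
  is an interval between the fixed points of two contractions (\<open>sync_interval\<close>).

  These fixed points solve the equations that define \<open>\<zeta>\<close> and \<open>\<eta>\<close>. Each equation is quadratic in \<open>\<beta>\<close>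
  with values of opposite signs at \<open>0\<close> and \<open>t\<close>, so it has no other solution with \<open>0 \<le> \<alpha> \<le> 1\<close>; hence the
  interval is \<open>\<J>\<^bsub>-k,v\<^esub>\<close> (\<open>J_int_iff\<close>). The partition of \<open>[\<epsilon>, 1)\<close> by the first digit is
  the computation of the integer part of \<open>(\<beta> + 1 / \<beta> + 1) / t\<close>.
\<close>

section \<open>The tree of words\<close>

abbreviation wpow :: "'a list \<Rightarrow> nat \<Rightarrow> 'a list" where
  "wpow w m \<equiv> concat (replicate m w)"

lemma wpow_commute: "w @ wpow w m = wpow w m @ w"
  by (induction m) auto

text \<open>A word over the two digits \<open>-k\<close> and \<open>-k-1\<close> is a list of booleans, \<^const>\<open>False\<close> standing for
  \<open>-k\<close> and \<^const>\<open>True\<close> for \<open>-k-1\<close>. If \<open>v\<close> is spelled by \<open>low U P\<close>, then \<open>v'\<close>, in which the first digit is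
  changed to \<open>-k-1\<close>, is spelled by \<open>high U P\<close>. For the pairs that belong to words of \<open>\<V>\<close> this change of the
  first digit amounts to the passage from \<open>U P False\<close> to \<open>P True U\<close>. In the second form the two words
  \<open>P False\<close> and \<open>P True U\<close> that can follow in an orbit are seen to part directly after \<open>P\<close>.\<close>

definition low :: "bool list \<Rightarrow> bool list \<Rightarrow> bool list" where
  "low U P = U @ P @ [False]"

definition high :: "bool list \<Rightarrow> bool list \<Rightarrow> bool list" where
  "high U P = P @ True # U"

text \<open>For a node with word \<open>w = low U P\<close> and raised word \<open>w' = high U P\<close>, the \<open>m\<close>-th child spells
  \<open>w w'\<^sup>m P False\<close>. Starting with the empty pair, which spells the single digit \<open>-k\<close>, this one rule covers the
  operators \<open>\<Theta>\<^sub>q\<close> on all words: the child with \<open>m = 0\<close> of the one-letter word \<open>c\<close> is \<open>c + 1\<close>, and the suffix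
  \<open>v''\<close> of \<open>v = u v''\<close> is spelled by \<open>P False\<close> when \<open>u\<close> is spelled by \<open>U\<close>.\<close>

inductive node :: "bool list \<Rightarrow> bool list \<Rightarrow> bool" where
  root: "node [] []"
| child: "node U P \<Longrightarrow> node (low U P) (wpow (high U P) m @ P)"

lemma low_child: "low (low U P) (wpow (high U P) m @ P) = low U P @ wpow (high U P) m @ P @ [False]"
  by (simp add: low_def)

lemma high_child: "high (low U P) (wpow (high U P) m @ P) = wpow (high U P) (Suc m) @ P @ [False]"
proof -
  have "wpow (high U P) (Suc m) @ P @ [False] = wpow (high U P) m @ high U P @ P @ [False]"
    by (simp add: wpow_commute flip: append_assoc)
  then show ?thesis by (simp add: high_def low_def)
qed

text \<open>For a child this holds because \<open>w'\<^sup>m w' P False = w'\<^sup>m P True w\<close>, where \<open>w' = P True U\<close> and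
  \<open>w = U P False\<close>.\<close>

lemma node_low_high:
  assumes "node U P"
  obtains X where "low U P = False # X" "high U P = True # X"
proof -
  have "\<exists>X. low U P = False # X \<and> high U P = True # X"
    using assms
  proof induction
    case root
    show ?case by (simp add: low_def high_def)
  next
    case (child U P m)
    then obtain X where X: "low U P = False # X" "high U P = True # X" by blast
    show ?case
      unfolding high_child low_child using X by simp
  qed
  then show thesis using that by blast
qed

lemma node_suffix_low:
  assumes "node U P"
  shows "strict_suffix U (low U P)"
proof -
  obtain X where X: "low U P = False # X" "high U P = True # X"
    using node_low_high[OF assms] .
  have "suffix U (True # X)"
    unfolding X(2)[symmetric] high_def by (simp add: suffix_def)
  moreover have "length U < length (True # X)"
    unfolding X(2)[symmetric] high_def by simp
  ultimately have "suffix U X"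
    by (auto simp: suffix_Cons)
  then show ?thesis unfolding X(1)
    by (auto simp: strict_suffix_def suffix_Cons dest: suffix_length_le)
qed

fun child_of :: "bool list \<times> bool list \<Rightarrow> nat \<Rightarrow> bool list \<times> bool list" where
  "child_of (U, P) m = (low U P, wpow (high U P) m @ P)"

lemma node_path:
  assumes "node U P"
  shows "\<exists>ms. foldl child_of ([], []) ms = (U, P)"
  using assms
proof induction
  case root
  show ?case by (rule exI[of _ "[]"]) simp
next
  case (child U P m)
  then obtain ms where "foldl child_of ([], []) ms = (U, P)" by blast
  then show ?case by (intro exI[of _ "ms @ [m]"]) simp
qed

lemma descendant_extends:
  "\<exists>Z. case_prod low (foldl child_of x ms) = case_prod low x @ Z \<and> (ms \<noteq> [] \<longrightarrow> Z \<noteq> [])"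
proof (induction ms arbitrary: x)
  case Nil
  show ?case by simp
next
  case (Cons m ms)
  obtain U P where x: "x = (U, P)" by (cases x)
  obtain Z where "case_prod low (foldl child_of (child_of x m) ms) = case_prod low (child_of x m) @ Z"
    using Cons by blast
  then show ?case by (simp add: x low_child)
qed

text \<open>After the shorter power one word goes on with \<open>P False\<close>, the other with a raised word, which begins
  with \<open>P True\<close>.\<close>

lemma siblings_diverge:
  assumes "m < m'"
  shows "wpow (high U P) m @ P @ False # Z \<noteq> wpow (high U P) m' @ P @ False # Z'"
proof
  assume eq: "wpow (high U P) m @ P @ False # Z = wpow (high U P) m' @ P @ False # Z'"
  obtain d where d: "m' = m + Suc d" using assms less_imp_Suc_add by auto
  show False
    using eq unfolding d replicate_add concat_append by (simp add: high_def)
qed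

lemma path_unique:
  "case_prod low (foldl child_of x ms) = case_prod low (foldl child_of x ms') \<Longrightarrow> ms = ms'"
proof (induction ms arbitrary: x ms')
  case Nil
  then show ?case using descendant_extends[of x ms'] by fastforce
next
  case (Cons m ms)
  obtain U P where x: "x = (U, P)" by (cases x)
  show ?case
  proof (cases ms')
    case Nil
    then show ?thesis using Cons.prems descendant_extends[of x "m # ms"] by fastforce
  next
    case (Cons m' ns)
    obtain Z where Z: "case_prod low (foldl child_of x (m # ms)) = case_prod low (child_of x m) @ Z"
      using descendant_extends[of "child_of x m" ms] by auto
    obtain Z' where Z': "case_prod low (foldl child_of x ms') = case_prod low (child_of x m') @ Z'"
      using descendant_extends[of "child_of x m'" ns] Cons by auto
    have "wpow (high U P) m @ P @ False # Z = wpow (high U P) m' @ P @ False # Z'"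
      using Cons.prems unfolding Z Z' by (simp add: x low_child)
    then have "m = m'"
      using siblings_diverge[of m m' U P Z Z'] siblings_diverge[of m' m U P Z' Z]
      by (metis linorder_neqE_nat)
    then show ?thesis
      using Cons.IH[of "child_of x m" ns] Cons.prems Cons by simp
  qed
qed

text \<open>Two different paths from the root part at some node, and from there on the two words disagree in the digit
  after the common copies of the raised word and of \<open>P\<close>. Hence a word determines its path and its
  factorisation; this makes \<open>\<Theta>\<^sub>q\<close> single-valued.\<close>

lemma node_unique:
  assumes "node U P" "node V R" "low U P = low V R"
  shows "U = V \<and> P = R"
proof -
  obtain ms where ms: "foldl child_of ([], []) ms = (U, P)" using node_path[OF assms(1)] by blast
  obtain ns where ns: "foldl child_of ([], []) ns = (V, R)" using node_path[OF assms(2)] by blast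
  have "ms = ns" using path_unique[of "([], [])" ms ns] assms(3) ms ns by simp
  then show ?thesis using ms ns by simp
qed

section \<open>Words in run-length form and the operators \<open>\<Theta>\<^sub>q\<close>\<close>

text \<open>The letters of a word are the lengths of alternating runs of \<open>c\<close> and its negation.\<close>

primrec enc :: "bool \<Rightarrow> nat list \<Rightarrow> bool list" where
  "enc c [] = []"
| "enc c (e # w) = replicate e c @ enc (\<not> c) w"

definition is_word :: "nat list \<Rightarrow> bool" where
  "is_word v \<longleftrightarrow> odd (length v) \<and> 0 \<notin> set v"

lemma enc_append: "enc c (u @ w) = enc c u @ enc (if even (length u) then c else \<not> c) w"
  by (induction u arbitrary: c) auto

lemma enc_wpow_even: "even (length w) \<Longrightarrow> enc c (wpow w m) = wpow (enc c w) m"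
  by (induction m) (auto simp: enc_append)

lemma replicate_run_eq:
  assumes "replicate e c @ u = replicate e' c @ u'" "u = [] \<or> hd u \<noteq> c" "u' = [] \<or> hd u' \<noteq> c"
  shows "e = e' \<and> u = u'"
  using assms
proof (induction e arbitrary: e')
  case 0
  then show ?case by (cases e') auto
next
  case (Suc e)
  then show ?case by (cases e') auto
qed

lemma hd_enc: "0 \<notin> set w \<Longrightarrow> enc c w = [] \<or> hd (enc c w) = c"
  by (cases w) auto

lemma enc_inj: "0 \<notin> set v \<Longrightarrow> 0 \<notin> set w \<Longrightarrow> enc c v = enc c w \<Longrightarrow> v = w"
proof (induction v arbitrary: c w)
  case Nil
  then show ?case by (cases w) auto
next
  case (Cons e v)
  then obtain e' w' where w: "w = e' # w'" by (cases w) auto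
  have "e = e' \<and> enc (\<not> c) v = enc (\<not> c) w'"
    using Cons.prems hd_enc[of v "\<not> c"] hd_enc[of w' "\<not> c"] w
    by (intro replicate_run_eq[of _ c]) auto
  then show ?case using Cons.IH[of w' "\<not> c"] Cons.prems w by auto
qed

lemma enc_word_prime:
  assumes "is_word v" "enc False v = False # X"
  shows "enc True (word_prime v) = True # X"
proof -
  obtain e w where v: "v = e # w" using assms by (cases v) auto
  have e: "e > 0" using assms v by (auto simp: is_word_def)
  show ?thesis
  proof (cases "e = 1")
    case True
    then show ?thesis using assms v by (cases w) auto
  next
    case False
    then obtain e' where "e = Suc (Suc e')" using e by (cases e; cases "e - 1") auto
    then show ?thesis using assms v by auto
  qed
qed

lemma word_prime_props:
  assumes "is_word v" "length v \<noteq> 1"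
  shows "even (length (word_prime v))" "0 \<notin> set (word_prime v)"
proof -
  obtain e w where v: "v = e # w" using assms by (cases v) (auto simp: is_word_def)
  show "even (length (word_prime v))" "0 \<notin> set (word_prime v)"
    using assms v by (auto simp: is_word_def split: list.splits)
qed

text \<open>The number of copies of the raised word inserted by \<open>\<Theta>\<^sub>q\<close>. On a one-letter word \<open>c > 1\<close> the index is shifted by
  one, since \<open>c[1(c-1)]\<^sup>q1c\<close> ends in a further copy of the raised word followed by the digit \<open>-k\<close>; on the word
  \<open>1\<close> the operator \<open>\<Theta>\<^bsub>-1\<^esub>\<close> inserts no copy and \<open>\<Theta>\<^sub>q\<close>, for \<open>q \<ge> 1\<close>, inserts \<open>q\<close>, so that no number is taken twice or
  omitted.\<close>

definition child_index :: "nat list \<Rightarrow> int \<Rightarrow> nat" where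
  "child_index v q = (if length v = 1 \<and> (v \<noteq> [1] \<or> q < 0) then nat (q + 1) else nat q)"

lemma wpow_set: "0 \<notin> set w \<Longrightarrow> 0 \<notin> set (wpow w m)"
  by (induction m) auto

lemma length_wpow: "length (wpow w m) = m * length w"
  by (induction m) auto

lemma node_letter: "node (replicate c False) []"
proof (induction c)
  case 0
  show ?case by (simp add: root)
next
  case (Suc c)
  then show ?case using node.child[of "replicate c False" "[]" 0]
    by (simp add: low_def replicate_append_same)
qed

text \<open>In the recursive case the parent \<open>u\<close> of \<open>v = u s\<close> gives the node of \<open>v\<close>, because its first component is the
  spelling of \<open>u\<close>, and its second component followed by \<open>False\<close> is the spelling of \<open>s\<close>.\<close>

lemma Theta_graph_node:
  assumes "Theta_graph q v w"
  shows "is_word v \<and> is_word w \<and> (\<exists>U P. node U P \<and> enc False v = low U P \<and>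
    enc False w = low U P @ wpow (high U P) (child_index v q) @ P @ [False])"
  using assms
proof induction
  case (minus_one c)
  then have c: "replicate c False = replicate (c - 1) False @ [False]"
    by (cases c) (auto simp: replicate_append_same)
  show ?case
    using minus_one node_letter[of "c - 1"] c
    by (intro conjI exI[of _ "replicate (c - 1) False"] exI[of _ "[]"])
       (auto simp: is_word_def child_index_def low_def replicate_append_same)
next
  case (one q)
  have "wpow [True] q = replicate q True" by (induction q) auto
  then show ?case
    using one root
    by (intro conjI exI[of _ "[]"] exI[of _ "[]"])
       (auto simp: is_word_def child_index_def low_def high_def)
next
  case (letter c q)
  have c: "replicate c False = replicate (c - 1) False @ [False]"
    using letter by (cases c) (auto simp: replicate_append_same)
  have pow: "enc True (wpow [1, c - 1] q) = wpow (True # replicate (c - 1) False) q"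
    using enc_wpow_even[of "[1, c - 1]" True q] by simp
  have len: "even (length (wpow [1, c - 1] q))" by (simp add: length_wpow)
  have "enc False ([c] @ word_power [1, c - 1] q @ [1, c]) =
     replicate c False @ wpow (True # replicate (c - 1) False) q @ True # replicate c False"
    unfolding word_power_def using len by (simp add: enc_append pow[unfolded One_nat_def])
  also have "True # replicate c False = (True # replicate (c - 1) False) @ [False]"
    using c by simp
  also have "wpow (True # replicate (c - 1) False) q @ \<dots> =
      wpow (True # replicate (c - 1) False) (Suc q) @ [False]"
    by (simp add: wpow_commute flip: append_assoc)
  finally have enc: "enc False ([c] @ word_power [1, c - 1] q @ [1, c]) =
     replicate c False @ wpow (True # replicate (c - 1) False) (Suc q) @ [False]" .
  have idx: "child_index [c] (int q) = Suc q" using letter by (auto simp: child_index_def)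
  have low: "low (replicate (c - 1) False) [] = replicate c False" using c by (simp add: low_def)
  have high: "high (replicate (c - 1) False) [] = True # replicate (c - 1) False"
    by (simp add: high_def)
  have "is_word ([c] @ word_power [1, c - 1] q @ [1, c])"
    using letter len wpow_set[of "[1, c - 1]" q] by (simp add: is_word_def word_power_def)
  moreover have "is_word [c]" "enc False [c] = replicate c False"
    using letter by (simp_all add: is_word_def)
  ultimately show ?case
    using node_letter[of "c - 1"] enc low high idx append_Nil by metis
next
  case (step p u v s q)
  obtain U P where UP: "node U P" "enc False u = low U P"
    "enc False v = low U P @ wpow (high U P) (child_index u (int p)) @ P @ [False]"
    using step.IH by blast
  define P1 where "P1 = wpow (high U P) (child_index u (int p)) @ P"
  have words: "is_word u" "is_word v" using step.IH by auto
  have node: "node (low U P) P1" unfolding P1_def by (rule node.child[OF UP(1)])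
  have v: "enc False v = low (low U P) P1" using UP(3) by (simp add: P1_def low_def)
  have "length s > 0"
  proof (rule ccontr)
    assume "\<not> length s > 0"
    then show False using UP(2,3) step.hyps by auto
  qed
  then have len: "length v \<noteq> 1"
    using step.hyps words by (cases u) (auto simp: is_word_def)
  have s: "enc True s = P1 @ [False]"
    using v UP(2) words(1) step.hyps(2)
    by (simp add: enc_append is_word_def low_def)
  obtain X where X: "low (low U P) P1 = False # X" "high (low U P) P1 = True # X"
    using node_low_high[OF node] .
  have prime: "enc True (word_prime v) = high (low U P) P1"
    using enc_word_prime[OF words(2)] v X by simp
  have pw: "enc True (wpow (word_prime v) q) = wpow (high (low U P) P1) q"
    using enc_wpow_even word_prime_props[OF words(2) len] prime by simp
  have even: "even (length (wpow (word_prime v) q))" 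
    using word_prime_props[OF words(2) len] by (simp add: length_wpow)
  have "enc False (v @ word_power (word_prime v) q @ s)
    = low (low U P) P1 @ wpow (high (low U P) P1) q @ P1 @ [False]"
    unfolding word_power_def using words(2) even
    by (simp add: enc_append v pw s is_word_def)
  moreover have "is_word (v @ word_power (word_prime v) q @ s)"
    using words step.hyps(2) even wpow_set[OF word_prime_props(2)[OF words(2) len], of q]
    by (auto simp: is_word_def word_power_def)
  moreover have "child_index v (int q) = q" using len by (simp add: child_index_def)
  ultimately show ?case using node v words by metis
qed

lemma Theta_graph_unique:
  assumes "Theta_graph q v w" "Theta_graph q v w'"
  shows "w = w'"
proof -
  obtain U P where UP: "node U P" "enc False v = low U P" "is_word w"
    "enc False w = low U P @ wpow (high U P) (child_index v q) @ P @ [False]"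
    using Theta_graph_node[OF assms(1)] by blast
  obtain U' P' where UP': "node U' P'" "enc False v = low U' P'" "is_word w'"
    "enc False w' = low U' P' @ wpow (high U' P') (child_index v q) @ P' @ [False]"
    using Theta_graph_node[OF assms(2)] by blast
  have "U = U' \<and> P = P'" using node_unique UP UP' by simp
  then show ?thesis using enc_inj[of w w' False] UP UP' by (simp add: is_word_def)
qed

lemma Theta_graph_extends: "Theta_graph q u v \<Longrightarrow> q \<ge> 0 \<Longrightarrow> \<exists>s. v = u @ s"
  by (cases rule: Theta_graph.cases) auto

lemma Vwords_parent:
  assumes "v \<in> Vwords" "length v \<noteq> 1"
  obtains p u s where "Theta_graph (int p) u v" "v = u @ s"
  using assms(1)
proof cases
  case 1
  then show ?thesis using assms by simp
next
  case (2 u q)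
  show ?thesis
  proof (cases "q \<ge> 0")
    case True
    then show ?thesis using 2 that[of "nat q" u] Theta_graph_extends[of q u v] by auto
  next
    case False
    from 2(2) False assms(2) show ?thesis by cases auto
  qed
qed

lemma Vwords_node:
  assumes "v \<in> Vwords"
  obtains U P where "node U P" "enc False v = low U P"
  using assms
proof cases
  case 1
  then show ?thesis using that[OF root] by (simp add: low_def)
next
  case (2 u q)
  then obtain U P where UP: "node U P"
    "enc False v = low U P @ wpow (high U P) (child_index u q) @ P @ [False]"
    using Theta_graph_node by blast
  show ?thesis using that[OF node.child[OF UP(1), of "child_index u q"]] UP(2) by (simp add: low_child)
qed

lemma Vwords_is_word: "v \<in> Vwords \<Longrightarrow> is_word v"
  by (induction rule: Vwords.induct) (auto simp: is_word_def dest: Theta_graph_node)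

lemma Theta_graph_Theta:
  assumes "v \<in> Vwords" "q \<in> Theta_index v"
  shows "Theta_graph q v (Theta q v)"
proof -
  have "\<exists>w. Theta_graph q v w"
  proof (cases "length v = 1")
    case True
    then obtain c where v: "v = [c]" by (cases v) auto
    have c: "c \<ge> 1" using Vwords_is_word[OF assms(1)] v by (auto simp: is_word_def)
    show ?thesis
    proof (cases "q = -1")
      case True
      then show ?thesis using Theta_graph.minus_one[OF c] v by blast
    next
      case False
      then have q: "q \<ge> 0" "c = 1 \<Longrightarrow> q \<ge> 1" using assms(2) v by (auto simp: Theta_index_def split: if_splits)
      show ?thesis
      proof (cases "c = 1")
        case True
        have "Theta_graph (int (nat q)) [1] [1, nat q, 1]" using Theta_graph.one[of "nat q"] q True by auto
        then show ?thesis using q v True by auto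
      next
        case False
        then show ?thesis using Theta_graph.letter[of c "nat q"] q v c by auto
      qed
    qed
  next
    case False
    then have "q \<ge> 0" using assms(2) by (auto simp: Theta_index_def split: if_splits)
    moreover obtain p u s where "Theta_graph (int p) u v" "v = u @ s"
      using Vwords_parent[OF assms(1) False] .
    ultimately show ?thesis using Theta_graph.step[of p u v s "nat q"] by auto
  qed
  then show ?thesis unfolding Theta_def using Theta_graph_unique by (metis theI)
qed

lemma enc_Theta:
  assumes "v \<in> Vwords" "q \<in> Theta_index v" "node U P" "enc False v = low U P"
  shows "enc False (Theta q v) = low (low U P) (wpow (high U P) (child_index v q) @ P)"
proof -
  obtain U' P' where UP: "node U' P'" "enc False v = low U' P'"
    "enc False (Theta q v) = low U' P' @ wpow (high U' P') (child_index v q) @ P' @ [False]"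
    using Theta_graph_node[OF Theta_graph_Theta[OF assms(1,2)]] by blast
  have "U' = U \<and> P' = P" using node_unique UP assms by simp
  then show ?thesis using UP by (simp add: low_child)
qed

lemma child_index_bij:
  assumes "v \<noteq> []"
  shows "bij_betw (child_index v) (Theta_index v) UNIV"
proof (rule bij_betw_byWitness[where f' =
    "\<lambda>m. if length v = 1 \<and> (v \<noteq> [1] \<or> m = 0) then int m - 1 else int m"])
qed (auto simp: child_index_def Theta_index_def split: if_splits)

section \<open>Inverse branches\<close>

text \<open>In the coordinate \<open>y = -x\<close> the digit \<open>-j\<close> acts by \<open>y \<mapsto> (j t - 1) - 1 / y\<close>. Here \<open>s = k t - 1\<close>, so that
  the digits \<open>-k\<close> and \<open>-k-1\<close> have the constants \<open>s\<close> and \<open>s + t\<close>.\<close>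

locale inverse_branches =
  fixes t s :: real
  assumes t2: "2 \<le> t" and s_ge: "2 * t - 1 \<le> s"
begin

text \<open>\<open>br w y\<close> is the point whose orbit follows the digits of \<open>w\<close> and then arrives at \<open>y\<close>.\<close>

primrec br :: "bool list \<Rightarrow> real \<Rightarrow> real" where
  "br [] y = y"
| "br (c # w) y = 1 / ((if c then s + t else s) - br w y)"

lemma s3: "3 \<le> s" using t2 s_ge by simp

lemma br_append: "br (u @ w) y = br u (br w y)"
  by (induction u) auto

lemma br_bounds: "y < 1 \<Longrightarrow> br w y < 1 \<and> (w \<noteq> [] \<longrightarrow> 0 < br w y \<and> br w y < 1 / 2)"
proof (induction w)
  case Nil
  then show ?case by simp
next
  case (Cons c w)
  then have "br w y < 1" by simp
  then have "2 < (if c then s + t else s) - br w y" using t2 s3 by auto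
  then show ?case by (auto simp: field_simps)
qed

lemmas br_less_1 = br_bounds[THEN conjunct1]

lemma br_pos: "y < 1 \<Longrightarrow> w \<noteq> [] \<Longrightarrow> 0 < br w y"
  using br_bounds by blast

lemma recip_diff:
  fixes c x y :: real
  assumes "x < y" "y < 1" "3 \<le> c"
  shows "1 / (c - x) < 1 / (c - y)" "1 / (c - y) - 1 / (c - x) \<le> (y - x) / 4"
proof -
  show "1 / (c - x) < 1 / (c - y)" using assms by (simp add: frac_less2)
  have "2 * 2 \<le> (c - y) * (c - x)" using assms by (intro mult_mono) auto
  then have "(y - x) / ((c - y) * (c - x)) \<le> (y - x) / 4"
    using assms by (intro divide_left_mono) auto
  moreover have "1 / (c - y) - 1 / (c - x) = (y - x) / ((c - y) * (c - x))"
    using assms by (simp add: field_simps)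
  ultimately show "1 / (c - y) - 1 / (c - x) \<le> (y - x) / 4" by simp
qed

lemma br_strict_mono: "x < y \<Longrightarrow> y < 1 \<Longrightarrow> br w x < br w y"
proof (induction w)
  case Nil
  then show ?case by simp
next
  case (Cons c w)
  then show ?case using recip_diff(1)[of "br w x" "br w y"] br_less_1[of y w] s3 t2 by simp
qed

lemma br_less_iff: "x < 1 \<Longrightarrow> y < 1 \<Longrightarrow> br w x < br w y \<longleftrightarrow> x < y"
  using br_strict_mono[of x y w] br_strict_mono[of y x w] by (cases x y rule: linorder_cases) auto

lemma br_le_iff: "x < 1 \<Longrightarrow> y < 1 \<Longrightarrow> br w x \<le> br w y \<longleftrightarrow> x \<le> y"
  using br_less_iff[of y x w] by (simp add: not_less[symmetric])

lemma br_contract: "x \<le> y \<Longrightarrow> y < 1 \<Longrightarrow> br w y - br w x \<le> (if w = [] then 1 else 1 / 4) * (y - x)"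
proof (induction w)
  case Nil
  then show ?case by simp
next
  case (Cons c w)
  show ?case
  proof (cases "x = y")
    case False
    then have lt: "br w x < br w y" using Cons.prems br_strict_mono[of x y w] by simp
    then have "br (c # w) y - br (c # w) x \<le> (br w y - br w x) / 4"
      using recip_diff(2)[of "br w x" "br w y"] br_less_1[of y w] s3 t2 Cons.prems by simp
    also have "\<dots> \<le> (y - x) / 4"
      using Cons by (auto split: if_splits)
    finally show ?thesis by simp
  qed simp
qed

text \<open>A point between two points with digits \<open>w\<close> has these digits too, because the inverse branches are
  increasing; the point where its orbit arrives can be computed step by step.\<close>

lemma br_between:
  assumes "br w l < x" "x \<le> br w r" "l < 1" "r < 1"
  shows "\<exists>y. l < y \<and> y \<le> r \<and> x = br w y"
  using assms
proof (induction w arbitrary: x)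
  case Nil
  then show ?case by auto
next
  case (Cons c w)
  define sc where "sc = (if c then s + t else s)"
  have sc: "sc \<ge> 3" using s3 t2 by (simp add: sc_def)
  have x: "1 / (sc - br w l) < x" "x \<le> 1 / (sc - br w r)"
    using Cons.prems by (simp_all add: sc_def)
  have pos: "0 < sc - br w l" "0 < sc - br w r"
    using sc br_less_1[of l w] br_less_1[of r w] Cons.prems by auto
  then have x0: "x > 0" using x(1) by (smt (verit) zero_less_divide_1_iff)
  have "br w l < sc - 1 / x" "sc - 1 / x \<le> br w r"
    using x pos x0 by (auto simp: field_simps)
  then obtain y where y: "l < y" "y \<le> r" "sc - 1 / x = br w y"
    using Cons.IH[of "sc - 1 / x"] Cons.prems by blast
  have "x = 1 / (sc - br w y)" using y(3)[symmetric] x0 by simp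
  then show ?case using y by (auto simp: sc_def)
qed

text \<open>Of two points with the same digits \<open>w\<close>, one that continues with \<open>-k-1\<close> lies below one that continues with
  \<open>-k\<close>, unless its next image exceeds the next image of the other by at least \<open>t\<close>.\<close>

lemma br_letters:
  assumes "x < 1" "br u z < x + t"
  shows "br (w @ True # u) z < br (w @ [False]) x"
proof -
  have "br (True # u) z < br [False] x"
    using assms s3 t2 by (simp add: frac_less2)
  moreover have "br [False] x < 1" using br_less_1[of x "[False]"] assms by simp
  ultimately show ?thesis by (simp only: br_append br_strict_mono)
qed

text \<open>Changing the first digit from \<open>-k\<close> to \<open>-k-1\<close> replaces \<open>1 / \<beta>\<close> by \<open>1 / \<beta> + t\<close>.\<close>

lemma br_raise:
  assumes "node U P" "y < 1"
  shows "br (high U P) y = br (low U P) y / (1 + t * br (low U P) y)"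
proof -
  obtain X where X: "low U P = False # X" "high U P = True # X"
    using node_low_high[OF assms(1)] .
  have "s - br X y > 0" using br_less_1[OF assms(2), of X] s3 by simp
  then show ?thesis using t2 by (simp add: X field_simps)
qed

lemma br_low: "br (low U P) y = br U (br (P @ [False]) y)"
  by (simp add: low_def br_append)

lemma suffix_wpow_cases:
  assumes "suffix Q (wpow w m @ R)" "w \<noteq> []"
  shows "suffix Q R \<or> (\<exists>Q1 i. strict_suffix Q1 w \<and> Q = Q1 @ wpow w i @ R)"
  using assms(1)
proof (induction m)
  case 0
  then show ?case by simp
next
  case (Suc m)
  from Suc.prems have "suffix Q (w @ (wpow w m @ R))" by simp
  then consider "suffix Q (wpow w m @ R)" | Q1 where "Q = Q1 @ wpow w m @ R" "suffix Q1 w"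
    by (auto simp: suffix_append)
  then show ?case
  proof cases
    case 1
    then show ?thesis by (rule Suc.IH)
  next
    case (2 Q1)
    show ?thesis
    proof (cases "Q1 = w")
      case True
      then have "Q = [] @ wpow w (Suc m) @ R" using 2 by simp
      then show ?thesis using assms(2) by (metis strict_suffix_def suffix_bot.bot_least)
    next
      case False
      then show ?thesis using 2 by (auto simp: strict_suffix_def)
    qed
  qed
qed

text \<open>For \<open>i > 0\<close> the word on the left begins with \<open>P True\<close>, so that \<open>br_letters\<close> applies.\<close>

lemma raised_le:
  assumes "x \<le> y" "y < 1" "0 < y"
  shows "br (wpow (high U P) i @ P @ [False]) x \<le> br (P @ [False]) y"
proof (cases i)
  case 0
  then show ?thesis using assms br_le_iff[of x y] by simp
next
  case (Suc j)
  define z where "z = br (U @ wpow (high U P) j @ P @ [False]) x"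
  have "z < 1" unfolding z_def using assms by (intro br_less_1) simp
  then have "br (P @ True # (U @ wpow (high U P) j @ P @ [False])) x < br (P @ [False]) y"
    using assms t2 by (intro br_letters) (auto simp: z_def)
  then show ?thesis by (simp add: Suc high_def)
qed

text \<open>This is what replaces all the inequalities in the definition of a cylinder by a single one. In the
  inductive step \<open>w = low U P\<close>, and a suffix of \<open>w w'\<^sup>m P False\<close> is a suffix of \<open>P False\<close>, or a suffix of \<open>w\<close>
  followed by copies of \<open>w'\<close> and by \<open>P False\<close>; proper suffixes of \<open>w'\<close> are suffixes of \<open>w\<close>, as the two
  words differ in the first digit only. The induction hypothesis applies to the part of the suffix inside
  \<open>w\<close>, and its premises hold by \<open>raised_le\<close>. The second point \<open>z\<close> is there for this step: the orbit
  enters the part inside \<open>w\<close> after different numbers of copies of \<open>w'\<close>, while \<open>y\<close> belongs to the parameter.\<close>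

lemma suffix_bound:
  assumes "node U P" "y < 1" "y \<le> br (P @ [False]) y" "z \<le> br (P @ [False]) y"
    "strict_suffix Q (low U P)"
  shows "br Q z \<le> br (low U P) y"
  using assms
proof (induction arbitrary: y z Q)
  case root
  then have "Q = []" by (auto simp: low_def strict_suffix_def suffix_Cons)
  then show ?case using root by (simp add: low_def)
next
  case (child U P m)
  let ?H = "high U P" and ?S = "P @ [False]"
  \<comment> \<open>the point reached from the parameter after the word \<open>low U P\<close> of the parent\<close>
  define yU where "yU = br (wpow ?H m @ ?S) y"
  have y1: "y < 1" and y: "y \<le> yU" and z: "z \<le> yU"
    using child.prems by (simp_all add: yU_def)
  have yU: "0 < yU" "yU < 1" unfolding yU_def using y1 br_pos br_less_1 by auto
  have \<beta>: "br (low (low U P) (wpow ?H m @ P)) y = br (low U P) yU"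
    by (simp add: low_child br_append yU_def)
  have raised: "br (wpow ?H i @ ?S) x \<le> br ?S yU" if "x \<le> yU" for i x
    using raised_le[OF that yU(2,1)] .
  have yUS: "yU \<le> br ?S yU" using raised[OF y, of m] by (simp add: yU_def)
  have IH: "br Q' z' \<le> br (low U P) yU" if "z' \<le> br ?S yU" "strict_suffix Q' (low U P)" for z' Q'
    using child.IH[OF yU(2) yUS that] .
  obtain X where X: "low U P = False # X" "?H = True # X"
    using node_low_high[OF child.hyps] .
  have strict_eq: "strict_suffix Q' ?H \<longleftrightarrow> strict_suffix Q' (low U P)" for Q'
    unfolding X by (auto simp: strict_suffix_def suffix_Cons dest: suffix_length_le)
  have "suffix Q (low U P @ wpow ?H m @ ?S)"
    using child.prems(4) by (simp add: low_child strict_suffix_def)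
  then consider (tail) "suffix Q (wpow ?H m @ ?S)"
    | (front) Q' where "Q = Q' @ wpow ?H m @ ?S" "suffix Q' (low U P)"
    using suffix_append by blast
  then show ?case unfolding \<beta>
  proof cases
    case (front Q')
    then have "strict_suffix Q' (low U P)"
      using child.prems(4) by (auto simp: low_child strict_suffix_def)
    then show "br Q z \<le> br (low U P) yU"
      using IH[OF raised[OF z, of m]] front(1) by (simp add: br_append)
  next
    case tail
    then consider (S) "suffix Q ?S" | (H) Q1 i where "strict_suffix Q1 ?H" "Q = Q1 @ wpow ?H i @ ?S"
      using suffix_wpow_cases[OF tail] X by auto
    then show "br Q z \<le> br (low U P) yU"
    proof cases
      case S
      show ?thesis
      proof (cases "Q = low U P")
        case True
        then show ?thesis using z yU(2) br_le_iff[of z yU] by simp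
      next
        case False
        have "suffix Q (low U P)" using S unfolding low_def suffix_append by blast
        then show ?thesis using IH[of z Q] z yUS False by (simp add: strict_suffix_def)
      qed
    next
      case (H Q1 i)
      then show ?thesis using IH[OF raised[OF z, of i]] strict_eq by (simp add: br_append)
    qed
  qed
qed

section \<open>Cylinders and their partition\<close>

text \<open>The parameter \<open>\<beta>\<close> stands for \<open>-\<ell>\<^sub>0 = (1 - \<alpha>) t\<close>, and the interval \<open>[\<ell>\<^sub>0, r\<^sub>0)\<close> becomes \<open>(\<beta> - t, \<beta>]\<close>. The proper
  suffixes of \<open>w\<close> give the points of the orbit of \<open>\<beta>\<close> after at least one digit.\<close>

definition cyl :: "bool list \<Rightarrow> real \<Rightarrow> bool" where
  "cyl w \<beta> \<longleftrightarrow> (\<exists>y. \<beta> = br w y \<and> (\<forall>Q. strict_suffix Q w \<longrightarrow> \<beta> - t < br Q y \<and> br Q y \<le> \<beta>))"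

text \<open>As \<open>U\<close> is a proper suffix of \<open>low U P\<close>, the condition for the suffix \<open>U\<close> reads
  \<open>br U y \<le> \<beta> = br U (br (P @ [False]) y)\<close>, which is the inequality on the right; by \<open>suffix_bound\<close> it implies
  all the others.\<close>

lemma cyl_node_iff:
  assumes "node U P" "\<beta> \<le> t"
  shows "cyl (low U P) \<beta> \<longleftrightarrow>
    (\<exists>y<1. \<beta> = br (low U P) y \<and> \<beta> - t < y \<and> y \<le> br (P @ [False]) y)"
proof
  assume "cyl (low U P) \<beta>"
  then obtain y where y: "\<beta> = br (low U P) y"
    "\<And>Q. strict_suffix Q (low U P) \<Longrightarrow> \<beta> - t < br Q y \<and> br Q y \<le> \<beta>"
    unfolding cyl_def by blast
  obtain X where X: "low U P = False # X"
    using node_low_high[OF assms(1)] .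
  have "br X y \<le> \<beta>" using y(2)[of X] X by (simp add: strict_suffix_def suffix_Cons)
  moreover have \<beta>: "\<beta> = 1 / (s - br X y)" using y(1) X by simp
  ultimately have "1 \<le> s - br X y" using assms(2) s_ge t2 by simp
  then have "\<beta> \<le> 1" using \<beta> by simp
  then have "2 \<le> s - br X y" using \<open>br X y \<le> \<beta>\<close> s3 by simp
  then have "\<beta> < 1" using \<beta> by simp
  moreover have "\<beta> - t < y \<and> y \<le> \<beta>" using y(2)[of "[]"] X by (simp add: strict_suffix_def)
  ultimately have y1: "y < 1" "\<beta> - t < y" by auto
  have "br U y \<le> br U (br (P @ [False]) y)"
    using y(2)[OF node_suffix_low[OF assms(1)]] y(1) by (simp add: br_low)
  then have "y \<le> br (P @ [False]) y"
    using br_le_iff[of y "br (P @ [False]) y" U] y1 br_less_1 by simp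
  then show "\<exists>y<1. \<beta> = br (low U P) y \<and> \<beta> - t < y \<and> y \<le> br (P @ [False]) y"
    using y(1) y1 by blast
next
  assume "\<exists>y<1. \<beta> = br (low U P) y \<and> \<beta> - t < y \<and> y \<le> br (P @ [False]) y"
  then obtain y where y: "y < 1" "\<beta> = br (low U P) y" "\<beta> - t < y" "y \<le> br (P @ [False]) y"
    by blast
  have "\<beta> - t < br Q y \<and> br Q y \<le> \<beta>" if "strict_suffix Q (low U P)" for Q
    using suffix_bound[OF assms(1) y(1,4,4) that] y br_pos[of y Q] assms(2)
    by (cases "Q = []") auto
  then show "cyl (low U P) \<beta>" unfolding cyl_def using y(2) by blast
qed

text \<open>Let \<open>z = br (P False) x\<close> be the point reached after the copies of \<open>w'\<close>. It is at most \<open>br (P False) y\<close>, so that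
  \<open>br U z \<le> \<beta> < x + t\<close>; comparing the digits after \<open>P\<close> gives \<open>br w' z < z\<close>. Applying the inverse branches of the
  copies of \<open>w'\<close> preserves this inequality.\<close>

lemma child_point:
  assumes "x < 1" "\<beta> - t < x" "\<beta> = br (low U P) y"
    and y_def: "y = br (wpow (high U P) m @ P @ [False]) x" and "x \<le> y"
  shows "y \<le> br (P @ [False]) y" "br (high U P) y < y"
proof -
  let ?H = "high U P" and ?S = "P @ [False]"
  have y: "0 < y" "y < 1" unfolding y_def using assms(1) br_pos br_less_1 by auto
  show "y \<le> br ?S y" using raised_le[OF assms(5) y(2,1), where U = U and P = P and i = m] by (simp add: y_def)
  define z where "z = br ?S x"
  have z: "z < 1" unfolding z_def using assms(1) br_less_1 by blast
  have "br U z \<le> br U (br ?S y)"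
    unfolding z_def using assms(1,5) y br_le_iff br_less_1 by simp
  then have "br U z \<le> \<beta>" by (simp add: assms(3) br_low)
  then have "br ?H z < z"
    unfolding high_def z_def using assms(1,2) z br_less_1
    by (intro br_letters) (auto simp: z_def)
  then have "br (wpow ?H m) (br ?H z) < br (wpow ?H m) z"
    using br_strict_mono z by blast
  moreover have "y = br (wpow ?H m) z" by (simp only: y_def z_def br_append)
  moreover have "br ?H (br (wpow ?H m) z) = br (wpow ?H m) (br ?H z)"
    by (simp only: br_append[symmetric] wpow_commute)
  ultimately show "br ?H y < y" by simp
qed

text \<open>A point \<open>z\<close> between \<open>br (P True U) z\<close> and \<open>br (P False) y\<close> has the digits \<open>P\<close>. If the next digit is not
  \<open>-k\<close>, it is \<open>-k-1\<close>, and the image lies between \<open>br U z\<close> and \<open>\<beta> = br U (br (P False) y)\<close>. So the orbit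
  continues with \<open>U\<close>, which completes a copy of the raised word \<open>P True U\<close>.\<close>

lemma child_or_raise:
  assumes "y < 1" "\<beta> = br (low U P) y" "br (high U P) z < z" "z \<le> br (P @ [False]) y"
  obtains (child) x where "z = br (P @ [False]) x" "\<beta> - t < x" "x \<le> y"
    | (raise) z' where "z = br (high U P) z'" "z < z'" "z' \<le> br (P @ [False]) y"
proof -
  let ?S = "P @ [False]"
  have S1: "br ?S y < 1" using assms(1) br_less_1 by blast
  have z1: "z < 1" using assms(4) S1 by simp
  have "br (True # U) z < 1" "br [False] y < 1" using z1 assms(1) br_less_1 by blast+
  then obtain u where u: "br (True # U) z < u" "u \<le> br [False] y" "z = br P u"
    using br_between[of P "br (True # U) z" z "br [False] y"] assms(3,4)
    unfolding high_def br_append by auto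
  have u0: "0 < u" using less_trans[OF br_pos[OF z1, of "True # U"] u(1)] by blast
  \<comment> \<open>the image of \<open>u\<close> under the digit \<open>-k\<close>; its image under \<open>-k-1\<close> is \<open>x + t\<close>\<close>
  define x where "x = s - 1 / u"
  have ux: "u = br [False] x" using u0 by (simp add: x_def)
  have sy: "s - y > 0" using assms(1) s3 by simp
  have "x \<le> y" using u(2) u0 sy by (simp add: x_def field_simps)
  show thesis
  proof (cases "\<beta> - t < x")
    case True
    then show thesis using child[of x] u(3) ux \<open>x \<le> y\<close> by (simp only: br_append)
  next
    case False
    have sU: "s + t - br U z > 0" using br_less_1[OF z1, of U] s3 t2 by simp
    have "br U z < x + t" using u(1) u0 sU by (simp add: x_def field_simps)
    moreover have "x + t \<le> br U (br ?S y)" using False assms(2) by (simp add: br_low)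
    ultimately obtain z' where z': "z < z'" "z' \<le> br ?S y" "x + t = br U z'"
      using br_between[OF _ _ z1 S1, of U "x + t"] by auto
    have "br (True # U) z' = u" using z'(3)[symmetric] u0 by (simp add: x_def)
    then have "z = br (high U P) z'" by (simp add: u(3) high_def br_append)
    then show thesis using raise z' by blast
  qed
qed

text \<open>Each copy of the raised word multiplies the distance \<open>z - br w' z\<close> by at least four, while this distance
  stays below \<open>1\<close>. So only finitely many copies can follow.\<close>

lemma child_exists:
  assumes "y < 1" "\<beta> = br (low U P) y"
    "br (high U P) z < z" "z \<le> br (P @ [False]) y" "1 < 4 ^ N * (z - br (high U P) z)"
  shows "\<exists>m x. z = br (wpow (high U P) m @ P @ [False]) x \<and> \<beta> - t < x \<and> x \<le> y"
  using assms(3-)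
proof (induction N arbitrary: z)
  case 0
  have "br (P @ [False]) y < 1" using assms(1) br_less_1 by blast
  then have "z < 1" using 0 by simp
  moreover have "high U P \<noteq> []" by (simp add: high_def)
  ultimately show ?case using 0 br_pos[of z "high U P"] by simp
next
  case (Suc N)
  from assms(1,2) Suc.prems(1,2) show ?case
  proof (cases rule: child_or_raise)
    case (child x)
    then show ?thesis by (intro exI[of _ 0] exI[of _ x]) simp
  next
    case (raise z')
    have "br (P @ [False]) y < 1" using assms(1) br_less_1 by blast
    then have "z' < 1" using raise(3) by simp
    then have "4 * (z - br (high U P) z) \<le> z' - z"
      using br_contract[of z z' "high U P"] raise by (simp add: high_def)
    then have "4 ^ N * (4 * (z - br (high U P) z)) \<le> 4 ^ N * (z' - z)"
      by (intro mult_left_mono) auto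
    then have "1 < 4 ^ N * (z' - br (high U P) z')"
      using Suc.prems(3) raise(1) by (simp add: algebra_simps)
    then obtain m x where "z' = br (wpow (high U P) m @ P @ [False]) x" "\<beta> - t < x" "x \<le> y"
      using Suc.IH[of z'] raise by auto
    then show ?thesis
      using raise(1) by (intro exI[of _ "Suc m"] exI[of _ x]) (simp add: br_append)
  qed
qed

text \<open>The bound on \<open>y\<close> says that \<open>y\<close> lies at or below the point with digit \<open>-k-1\<close> whose image is the image of
  \<open>\<beta>\<close> under the digit \<open>-k\<close>.\<close>

definition sync :: "bool list \<Rightarrow> bool list \<Rightarrow> real \<Rightarrow> bool" where
  "sync U P \<beta> \<longleftrightarrow> (\<exists>y<1. \<beta> = br (low U P) y \<and> \<beta> - t < y \<and> y \<le> \<beta> / (1 + t * \<beta>))"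

lemma sync_iff:
  assumes "node U P"
  shows "sync U P \<beta> \<longleftrightarrow> (\<exists>y<1. \<beta> = br (low U P) y \<and> \<beta> - t < y \<and> y \<le> br (high U P) y)"
  unfolding sync_def using br_raise[OF assms] by auto

lemma cyl_child_iff:
  assumes "node U P" "\<beta> \<le> t"
  shows "cyl (low (low U P) (wpow (high U P) m @ P)) \<beta> \<longleftrightarrow> (\<exists>x<1.
    \<beta> = br (low U P) (br (wpow (high U P) m @ P @ [False]) x) \<and> \<beta> - t < x \<and>
    x \<le> br (wpow (high U P) m @ P @ [False]) x)"
  unfolding cyl_node_iff[OF node.child[OF assms(1)] assms(2)] by (simp add: low_child br_append)

text \<open>Let \<open>y\<close> be the point reached from \<open>\<beta>\<close> by the word \<open>w\<close>. The comparison of \<open>y\<close> with \<open>br w' y\<close> decides: if \<open>y\<close>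
  is not larger, the parameter belongs to the synchronisation interval; otherwise the orbit of \<open>y\<close> follows
  \<open>w'\<close> a number of times and then \<open>P False\<close>, so that a child begins.\<close>

theorem cyl_partition:
  assumes "node U P" "\<beta> \<le> t"
  shows "cyl (low U P) \<beta> \<longleftrightarrow>
    sync U P \<beta> \<or> (\<exists>m. cyl (low (low U P) (wpow (high U P) m @ P)) \<beta>)"
proof
  assume "cyl (low U P) \<beta>"
  then obtain y where y: "y < 1" "\<beta> = br (low U P) y" "\<beta> - t < y" "y \<le> br (P @ [False]) y"
    unfolding cyl_node_iff[OF assms] by blast
  show "sync U P \<beta> \<or> (\<exists>m. cyl (low (low U P) (wpow (high U P) m @ P)) \<beta>)"
  proof (cases "y \<le> br (high U P) y")
    case True
    then show ?thesis using y sync_iff[OF assms(1)] by blast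
  next
    case False
    \<comment> \<open>after \<open>N\<close> copies of the raised word the distance to the inverse image would exceed \<open>1\<close>\<close>
    then obtain N where "1 / (y - br (high U P) y) < 4 ^ N"
      using real_arch_pow[of 4] by auto
    then have "1 < 4 ^ N * (y - br (high U P) y)" using False by (simp add: field_simps)
    then obtain m x where x: "y = br (wpow (high U P) m @ P @ [False]) x" "\<beta> - t < x" "x \<le> y"
      using child_exists[OF y(1,2), of y N] y False by auto
    moreover have "x < 1" using x y by simp
    ultimately show ?thesis
      unfolding cyl_child_iff[OF assms] using y(2) by metis
  qed
next
  assume "sync U P \<beta> \<or> (\<exists>m. cyl (low (low U P) (wpow (high U P) m @ P)) \<beta>)"
  then show "cyl (low U P) \<beta>"
  proof
    assume "sync U P \<beta>"
    then obtain y where y: "y < 1" "\<beta> = br (low U P) y" "\<beta> - t < y" "y \<le> br (high U P) y"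
      unfolding sync_iff[OF assms(1)] by blast
    have "y \<le> br (P @ [False]) y"
    proof (rule ccontr)
      assume neg: "\<not> y \<le> br (P @ [False]) y"
      then have "0 < y" using br_pos[OF y(1), of "P @ [False]"] by simp
      then have "br (P @ True # U) y < br (P @ [False]) y"
        using y(1) t2 br_less_1[OF y(1), of U] by (intro br_letters) auto
      then show False using neg y(4) by (simp add: high_def)
    qed
    then show ?thesis unfolding cyl_node_iff[OF assms] using y by blast
  next
    assume "\<exists>m. cyl (low (low U P) (wpow (high U P) m @ P)) \<beta>"
    then obtain m x where x: "x < 1" "\<beta> = br (low U P) (br (wpow (high U P) m @ P @ [False]) x)"
      "\<beta> - t < x" "x \<le> br (wpow (high U P) m @ P @ [False]) x"
      unfolding cyl_child_iff[OF assms] by blast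
    define y where "y = br (wpow (high U P) m @ P @ [False]) x"
    have "y < 1" unfolding y_def using x(1) br_less_1 by blast
    moreover have "y \<le> br (P @ [False]) y"
      using child_point(1)[OF x(1,3), where y = y and m = m] x y_def by blast
    ultimately show ?thesis unfolding cyl_node_iff[OF assms] using x y_def
      by (intro exI[of _ y]) auto
  qed
qed

lemma br_inj: "x < 1 \<Longrightarrow> y < 1 \<Longrightarrow> br w x = br w y \<Longrightarrow> x = y"
  using br_less_iff[of x y w] br_less_iff[of y x w] by auto

lemma sync_not_child:
  assumes "node U P" "\<beta> \<le> t" "sync U P \<beta>"
  shows "\<not> cyl (low (low U P) (wpow (high U P) m @ P)) \<beta>"
proof
  assume "cyl (low (low U P) (wpow (high U P) m @ P)) \<beta>"
  then obtain x where x: "x < 1" "\<beta> = br (low U P) (br (wpow (high U P) m @ P @ [False]) x)"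
    "\<beta> - t < x" "x \<le> br (wpow (high U P) m @ P @ [False]) x"
    unfolding cyl_child_iff[OF assms(1,2)] by blast
  define z where "z = br (wpow (high U P) m @ P @ [False]) x"
  have z: "z < 1" unfolding z_def using x(1) br_less_1 by blast
  have less: "br (high U P) z < z"
    using child_point(2)[OF x(1,3), where y = z and m = m] x z_def by blast
  obtain y where y: "y < 1" "\<beta> = br (low U P) y" "y \<le> br (high U P) y"
    using assms(3) unfolding sync_iff[OF assms(1)] by blast
  have "y = z" using br_inj[OF y(1) z, of "low U P"] x(2) y(2) by (simp add: z_def)
  then show False using y less by simp
qed

text \<open>A parameter in two of the cylinders has a point in its orbit with both digits \<open>-k\<close> and \<open>-k-1\<close> after the
  common part. Its two images differ by \<open>t\<close>, but they lie in a half-open interval of length \<open>t\<close>.\<close>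

lemma children_disjoint:
  assumes "node U P" "\<beta> \<le> t" "i < j"
    and "cyl (low (low U P) (wpow (high U P) i @ P)) \<beta>"
    and "cyl (low (low U P) (wpow (high U P) j @ P)) \<beta>"
  shows False
proof -
  let ?H = "high U P" and ?S = "P @ [False]"
  obtain x where x: "x < 1" "\<beta> = br (low U P) (br (wpow ?H i @ ?S) x)" "\<beta> - t < x"
    using assms(4) unfolding cyl_child_iff[OF assms(1,2)] by blast
  obtain x' where x': "x' < 1" "\<beta> = br (low U P) (br (wpow ?H j @ ?S) x')"
    "x' \<le> br (wpow ?H j @ ?S) x'"
    using assms(5) unfolding cyl_child_iff[OF assms(1,2)] by blast
  obtain d where d: "j = i + Suc d" using assms(3) less_imp_Suc_add by auto
  define y where "y = br (wpow ?H j @ ?S) x'"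
  define z where "z = br (wpow ?H d @ ?S) x'"
  have y: "0 < y" "y < 1" unfolding y_def using x'(1) br_pos br_less_1 by auto
  have z: "z < 1" unfolding z_def using x'(1) br_less_1 by blast
  have "br (wpow ?H i @ ?S) x = y"
    using br_inj[of "br (wpow ?H i @ ?S) x" y "low U P"] x x'(2) y br_less_1 by (simp add: y_def)
  also have "y = br (wpow ?H i @ ?H) z"
    unfolding y_def z_def d replicate_add concat_append by (simp add: br_append)
  finally have "br (wpow ?H i @ P) (br [False] x) = br (wpow ?H i @ P) (br (True # U) z)"
    by (simp only: high_def br_append)
  then have "br [False] x = br (True # U) z"
    using br_inj br_less_1[OF x(1)] br_less_1[OF z] by blast
  then have "s - x = s + t - br U z" by simp
  moreover have "br U z \<le> br U (br ?S y)"
    using raised_le[OF _ y(2,1), where x = x' and U = U and P = P and i = d] x'(3) br_le_iff[OF z br_less_1[OF y(2)]]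
    by (simp add: z_def y_def)
  moreover have "br U (br ?S y) = \<beta>" using x'(2) by (simp add: y_def br_low)
  ultimately show False using x(3) by simp
qed

lemma continuous_on_br:
  assumes "continuous_on A f" "\<And>x. x \<in> A \<Longrightarrow> f x < 1"
  shows "continuous_on A (\<lambda>x. br w (f x))"
proof (induction w)
  case Nil
  then show ?case using assms by simp
next
  case (Cons c w)
  have "(if c then s + t else s) - br w (f x) \<noteq> 0" if "x \<in> A" for x
    using br_less_1[OF assms(2)[OF that], of w] s3 t2 by auto
  then show ?case using Cons by (auto intro!: continuous_intros)
qed

text \<open>The map \<open>x \<mapsto> x - br w (f x)\<close> is strictly increasing because \<open>br w\<close> contracts, and it changes sign on
  \<open>[0, 1]\<close>.\<close>

lemma br_fixed_point:
  assumes "w \<noteq> []" "continuous_on {0..1} f" "\<And>x. 0 \<le> x \<Longrightarrow> x \<le> 1 \<Longrightarrow> f x < 1"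
    and "\<And>x y. 0 \<le> x \<Longrightarrow> x \<le> y \<Longrightarrow> y \<le> 1 \<Longrightarrow> f x \<le> f y \<and> f y - f x \<le> y - x"
  shows "\<exists>b. 0 < b \<and> b < 1 \<and> br w (f b) = b \<and>
    (\<forall>x\<in>{0..1}. (br w (f x) < x \<longleftrightarrow> b < x) \<and> (x \<le> br w (f x) \<longleftrightarrow> x \<le> b))"
proof -
  define g where "g x = x - br w (f x)" for x
  have mono: "g x < g y" if "0 \<le> x" "x < y" "y \<le> 1" for x y
  proof -
    have "br w (f y) - br w (f x) \<le> 1 / 4 * (f y - f x)"
      using br_contract[of "f x" "f y" w] assms that by simp
    also have "\<dots> < y - x" using assms(4)[of x y] that by simp
    finally show ?thesis by (simp add: g_def)
  qed
  have "continuous_on {0..1} g" unfolding g_def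
    using assms by (intro continuous_intros continuous_on_br) auto
  moreover have "g 0 \<le> 0" "g 1 \<ge> 0"
    using br_pos[OF assms(3), of 0 w] br_less_1[OF assms(3), of 1 w] assms(1) by (auto simp: g_def)
  ultimately obtain b where b: "0 \<le> b" "b \<le> 1" "g b = 0"
    using IVT'[of g 0 0 1] by auto
  have fb: "br w (f b) = b" using b by (simp add: g_def)
  have "0 < b \<and> b < 1"
    using br_pos[OF assms(3), of b w] br_less_1[OF assms(3), of b w] assms(1) b fb by auto
  moreover have "(br w (f x) < x \<longleftrightarrow> b < x) \<and> (x \<le> br w (f x) \<longleftrightarrow> x \<le> b)" if "x \<in> {0..1}" for x
    using mono[of x b] mono[of b x] b that unfolding g_def by (cases x b rule: linorder_cases) auto
  ultimately show ?thesis using fb by blast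
qed

text \<open>The point \<open>y\<close> with \<open>\<beta> = br w y\<close> exists and lies in \<open>(\<beta> - t, \<beta> / (1 + t \<beta>)]\<close> iff
  \<open>br w (\<beta> - t) < \<beta> \<le> br w (\<beta> / (1 + t \<beta>))\<close>. Both bounds are contractions in \<open>\<beta>\<close>, so each inequality says
  on which side of a fixed point \<open>\<beta>\<close> lies.\<close>

lemma sync_interval:
  obtains bz be where "0 < bz" "bz < 1" "br (low U P) (bz - t) = bz"
    "0 < be" "be < 1" "br (low U P) (be / (1 + t * be)) = be"
    "\<And>\<beta>. 0 \<le> \<beta> \<Longrightarrow> \<beta> \<le> t \<Longrightarrow> sync U P \<beta> \<longleftrightarrow> bz < \<beta> \<and> \<beta> \<le> be"
proof -
  let ?w = "low U P"
  have w: "?w \<noteq> []" by (simp add: low_def)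
  have den: "1 + t * x > 0" if "0 \<le> x" for x :: real
    using that t2 by (smt (verit) mult_nonneg_nonneg)
  have q1: "x / (1 + t * x) < 1" if "0 \<le> x" "x \<le> 1" for x :: real
  proof -
    have "x \<le> t * x" using mult_right_mono[of 1 t x] t2 that by simp
    then show ?thesis using den[OF that(1)] by simp
  qed
  have q2: "x / (1 + t * x) \<le> y / (1 + t * y) \<and> y / (1 + t * y) - x / (1 + t * x) \<le> y - x"
    if "0 \<le> x" "x \<le> y" "y \<le> 1" for x y :: real
  proof -
    have d: "1 + t * x \<ge> 1" "1 + t * y \<ge> 1" using that t2 by auto
    then have ge: "1 \<le> (1 + t * y) * (1 + t * x)" using mult_mono[of 1 "1 + t * y" 1 "1 + t * x"] by simp
    have eq: "y / (1 + t * y) - x / (1 + t * x) = (y - x) / ((1 + t * y) * (1 + t * x))"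
      using d by (simp add: field_simps)
    have "0 \<le> (y - x) / ((1 + t * y) * (1 + t * x))" using ge that by simp
    moreover have "(y - x) / ((1 + t * y) * (1 + t * x)) \<le> (y - x) / 1"
      using ge that by (intro divide_left_mono) auto
    ultimately show ?thesis using eq by simp
  qed
  have z1: "x - t < 1" if "0 \<le> x" "x \<le> 1" for x using that t2 by simp
  have z2: "x - t \<le> y - t \<and> (y - t) - (x - t) \<le> y - x" if "0 \<le> x" "x \<le> y" "y \<le> 1" for x y
    using that by simp
  have "continuous_on {0..1} (\<lambda>x. x - t)" by (intro continuous_intros)
  then have "\<exists>b. 0 < b \<and> b < 1 \<and> br ?w (b - t) = b \<and>
    (\<forall>x\<in>{0..1}. (br ?w (x - t) < x \<longleftrightarrow> b < x) \<and> (x \<le> br ?w (x - t) \<longleftrightarrow> x \<le> b))"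
    by (rule br_fixed_point[OF w]) (use z1 z2 in simp_all)
  then obtain bz where bz: "0 < bz" "bz < 1" "br ?w (bz - t) = bz"
    "\<And>x. 0 \<le> x \<Longrightarrow> x \<le> 1 \<Longrightarrow> br ?w (x - t) < x \<longleftrightarrow> bz < x"
    by auto
  have "continuous_on {0..1} (\<lambda>x. x / (1 + t * x))"
  proof (intro continuous_intros ballI)
    fix x :: real assume "x \<in> {0..1}"
    then show "1 + t * x \<noteq> 0" using den[of x] by simp
  qed
  then have "\<exists>b. 0 < b \<and> b < 1 \<and> br ?w (b / (1 + t * b)) = b \<and>
    (\<forall>x\<in>{0..1}. (br ?w (x / (1 + t * x)) < x \<longleftrightarrow> b < x) \<and> (x \<le> br ?w (x / (1 + t * x)) \<longleftrightarrow> x \<le> b))"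
    by (rule br_fixed_point[OF w]) (fact q1 q2)+
  then obtain be where be: "0 < be" "be < 1" "br ?w (be / (1 + t * be)) = be"
    "\<And>x. 0 \<le> x \<Longrightarrow> x \<le> 1 \<Longrightarrow> x \<le> br ?w (x / (1 + t * x)) \<longleftrightarrow> x \<le> be"
    by auto
  show thesis
  proof (rule that[OF bz(1-3) be(1-3)])
    fix \<beta> assume \<beta>: "0 \<le> \<beta>" "\<beta> \<le> t"
    show "sync U P \<beta> \<longleftrightarrow> bz < \<beta> \<and> \<beta> \<le> be"
    proof
      assume "sync U P \<beta>"
      then obtain y where y: "y < 1" "\<beta> = br ?w y" "\<beta> - t < y" "y \<le> \<beta> / (1 + t * \<beta>)"
        unfolding sync_def by blast
      have \<beta>1: "\<beta> \<le> 1" using y br_less_1[OF y(1), of ?w] by simp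
      have "br ?w (\<beta> - t) < \<beta>" using br_strict_mono[OF y(3,1)] y(2) by simp
      moreover have "\<beta> \<le> br ?w (\<beta> / (1 + t * \<beta>))"
        using br_le_iff[OF y(1) q1[OF \<beta>(1) \<beta>1]] y(2,4) by simp
      ultimately show "bz < \<beta> \<and> \<beta> \<le> be" using bz(4) be(4) \<beta> \<beta>1 by simp
    next
      assume b: "bz < \<beta> \<and> \<beta> \<le> be"
      then have \<beta>1: "\<beta> \<le> 1" using be by simp
      have "br ?w (\<beta> - t) < \<beta>" "\<beta> \<le> br ?w (\<beta> / (1 + t * \<beta>))"
        using b bz(4) be(4) \<beta> \<beta>1 by auto
      then obtain y where "\<beta> - t < y" "y \<le> \<beta> / (1 + t * \<beta>)" "\<beta> = br ?w y"
        using br_between[of ?w "\<beta> - t" \<beta> "\<beta> / (1 + t * \<beta>)"] q1[OF \<beta>(1) \<beta>1] \<beta>1 t2 by auto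
      then show "sync U P \<beta>" unfolding sync_def using q1[OF \<beta>(1) \<beta>1]
        by (intro exI[of _ y]) auto
    qed
  qed
qed

end

section \<open>The Moebius action and the end point equations\<close>

definition mat2 :: "real \<Rightarrow> real \<Rightarrow> real \<Rightarrow> real \<Rightarrow> real^2^2" where
  "mat2 a b c d = vector [vector [a, b], vector [c, d]]"

lemma mat2_nth [simp]: "mat2 a b c d $ 1 $ 1 = a" "mat2 a b c d $ 1 $ 2 = b"
    "mat2 a b c d $ 2 $ 1 = c" "mat2 a b c d $ 2 $ 2 = d"
  by (simp_all add: mat2_def)

lemma mat2_eqI: "M $ 1 $ 1 = a \<Longrightarrow> M $ 1 $ 2 = b \<Longrightarrow> M $ 2 $ 1 = c \<Longrightarrow> M $ 2 $ 2 = d \<Longrightarrow> M = mat2 a b c d"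
  by (simp add: vec_eq_iff forall_2)

lemma mat2_mult [simp]: "mat2 a b c d ** mat2 a' b' c' d' =
    mat2 (a * a' + b * c') (a * b' + b * d') (c * a' + d * c') (c * b' + d * d')"
  by (rule mat2_eqI) (simp_all add: matrix_matrix_mult_def sum_2)

lemma mat_1_mat2: "mat 1 = mat2 1 0 0 1"
  by (rule mat2_eqI) (simp_all add: mat_def)

lemma moebius_act_mat2: "moebius_act (mat2 a b c d) (Some x) =
    (if c * x + d = 0 then None else Some ((a * x + b) / (c * x + d)))"
  by (simp add: moebius_act_def)

lemma moebius_act_compose:
  assumes "c * x + d \<noteq> 0"
  shows "moebius_act (M ** mat2 a b c d) (Some x) = moebius_act M (Some ((a * x + b) / (c * x + d)))"
proof -
  define v where "v = c * x + d"
  define z where "z = (a * x + b) / v"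
  have v: "v \<noteq> 0" "a * x + b = z * v" using assms by (simp_all add: v_def z_def)
  have M: "M = mat2 (M $ 1 $ 1) (M $ 1 $ 2) (M $ 2 $ 1) (M $ 2 $ 2)" by (rule mat2_eqI) simp_all
  have row: "(e * a + f * c) * x + (e * b + f * d) = (e * z + f) * v" for e f
  proof -
    have "(e * a + f * c) * x + (e * b + f * d) = e * (a * x + b) + f * (c * x + d)"
      by (simp add: algebra_simps)
    then show ?thesis unfolding v(2) v_def[symmetric] by (simp add: algebra_simps)
  qed
  show ?thesis
    apply (subst (1 2) M)
    unfolding mat2_mult moebius_act_mat2 row v_def[symmetric] z_def[symmetric]
    using v(1) by simp
qed

lemma matrix_inv_eqI:
  fixes A B :: "real^'n^'n"
  assumes "A ** B = mat 1" "B ** A = mat 1"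
  shows "matrix_inv A = B"
proof -
  have inv: "A ** matrix_inv A = mat 1 \<and> matrix_inv A ** A = mat 1"
    unfolding matrix_inv_def by (rule someI[of _ B]) (simp add: assms)
  have "matrix_inv A = matrix_inv A ** (A ** B)" by (simp add: assms)
  also have "\<dots> = B" unfolding matrix_mul_assoc using inv by simp
  finally show ?thesis .
qed

lemma matA_mat2: "matA n = mat2 1 (tpar n) 0 1" by (simp add: matA_def mat2_def)

lemma matC_mat2: "matC = mat2 (-1) 1 (-1) 0" by (simp add: matC_def mat2_def)

lemma inv_matA: "matrix_inv (matA n) = mat2 1 (- tpar n) 0 1"
  by (rule matrix_inv_eqI) (simp_all add: matA_mat2 mat_1_mat2)

lemma inv_matC: "matrix_inv matC = mat2 0 (-1) 1 (-1)"
  by (rule matrix_inv_eqI) (simp_all add: matC_mat2 mat_1_mat2)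

lemma mat_power_0: "mat_power M 0 = mat 1" by (simp add: mat_power_def)

lemma mat_power_Suc: "mat_power M (Suc i) = M ** mat_power M i" by (simp add: mat_power_def)

lemma mat_power_Suc_right: "mat_power M (Suc i) = mat_power M i ** M"
  by (induction i) (simp add: mat_power_0 mat_power_Suc, metis mat_power_Suc matrix_mul_assoc)

lemma matA_power: "mat_int_power (matA n) (- int j) = mat2 1 (- (real j * tpar n)) 0 1"
proof -
  have "mat_power (matrix_inv (matA n)) j = mat2 1 (- (real j * tpar n)) 0 1" for j
    by (induction j) (simp_all add: mat_power_0 mat_power_Suc mat_1_mat2 inv_matA algebra_simps)
  then show ?thesis by (cases j) (simp_all add: mat_int_power_def mat_power_0 mat_1_mat2 add.commute)
qed

lemma digit_matrix: "mat_int_power (matA n) (- int j) ** matC = mat2 (real j * tpar n - 1) 1 (-1) 0"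
  by (simp add: matA_power matC_mat2)

text \<open>With two different roots in \<open>[0, t]\<close> the values at \<open>0\<close> and at \<open>t\<close> would have the same sign.\<close>

lemma quadratic_root_unique:
  fixes a b c t x y :: real
  assumes "a * x\<^sup>2 + b * x + c = 0" "a * y\<^sup>2 + b * y + c = 0" "0 \<le> x" "x \<le> t" "0 \<le> y" "y \<le> t"
    "0 < c" "a * t\<^sup>2 + b * t + c < 0"
  shows "x = y"
proof (rule ccontr)
  assume ne: "x \<noteq> y"
  have "(x - y) * (a * (x + y) + b) = 0" using assms(1,2) by (simp add: algebra_simps power2_eq_square)
  then have b: "b = - (a * (x + y))" using ne by simp
  have c: "c = a * (x * y)" using assms(1) unfolding b by (simp add: algebra_simps power2_eq_square)
  have "a > 0" using assms(3,5,7) unfolding c by (smt (verit) mult_nonneg_nonneg zero_less_mult_iff)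
  have "a * t\<^sup>2 + b * t + c = a * ((t - x) * (t - y))"
    unfolding b c by (simp add: algebra_simps power2_eq_square)
  also have "\<dots> \<ge> 0" using \<open>a > 0\<close> assms by simp
  finally show False using assms(8) by simp
qed

context inverse_branches
begin

text \<open>The matrix acting on \<open>x = -y\<close> as the successive digits of the word.\<close>

primrec wmat :: "bool list \<Rightarrow> real^2^2" where
  "wmat [] = mat 1"
| "wmat (c # w) = wmat w ** mat2 (if c then s + t else s) 1 (-1) 0"

lemma wmat_act: "y < 1 \<Longrightarrow> moebius_act (wmat w) (Some (- br w y)) = Some (- y)"
proof (induction w)
  case Nil
  show ?case by (simp add: mat_1_mat2 moebius_act_mat2)
next
  case (Cons c w)
  define x where "x = br (c # w) y"
  define a where "a = (if c then s + t else s)"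
  have "a - br w y > 0" using br_less_1[OF Cons.prems, of w] s3 t2 by (auto simp: a_def)
  moreover have x: "x = 1 / (a - br w y)" by (simp add: x_def a_def)
  ultimately have x0: "x \<noteq> 0" and "1 / x = a - br w y" by simp_all
  then have z: "(a * - x + 1) / (- 1 * - x + 0) = - br w y" by (simp add: field_simps)
  have "moebius_act (wmat (c # w)) (Some (- x)) = moebius_act (wmat w) (Some ((a * - x + 1) / (- 1 * - x + 0)))"
    unfolding wmat.simps a_def[symmetric] by (rule moebius_act_compose) (simp add: x0)
  then show ?case unfolding z using Cons x_def by simp
qed

text \<open>These inequalities are preserved when a digit is put in front of the word, and they determine the signs
  at \<open>0\<close> and \<open>t\<close> of the two quadratics that vanish at the end points of a synchronisation interval.\<close>

lemma wmat_entries: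
  "\<exists>p q r u. wmat w = mat2 p q (- r) (- u) \<and> q < p \<and> 0 \<le> q \<and> 0 \<le> r \<and> u \<le> r \<and> u < q \<and>
     q - u \<le> p - r \<and> (w \<noteq> [] \<longrightarrow> 0 < q \<and> 0 \<le> u)"
proof (induction w)
  case Nil
  show ?case
    by (rule exI[of _ 1], rule exI[of _ 0], rule exI[of _ 0], rule exI[of _ "-1"]) (simp add: mat_1_mat2)
next
  case (Cons c w)
  then obtain p q r u where m: "wmat w = mat2 p q (- r) (- u)" "q < p" "0 \<le> q" "0 \<le> r" "u \<le> r"
    "u < q" "q - u \<le> p - r" by blast
  define a where "a = (if c then s + t else s)"
  have a: "3 \<le> a" using s3 t2 by (simp add: a_def)
  have "3 * p \<le> a * p" "3 * r \<le> a * r" "3 * (p - r) \<le> a * (p - r)"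
    using a m mult_right_mono[of 3 a "p - r"] by (auto intro!: mult_right_mono)
  then have "p < p * a - q" "0 \<le> p" "0 \<le> r * a - u" "r \<le> r * a - u" "r < p"
    "p - r \<le> p * a - q - (r * a - u)" "0 < p"
    using m by (auto simp: algebra_simps)
  moreover have "wmat (c # w) = mat2 (p * a - q) p (- (r * a - u)) (- r)"
    unfolding wmat.simps a_def[symmetric] m by (simp add: algebra_simps)
  ultimately show ?case using m(4) by blast
qed

text \<open>The equation that defines \<open>\<zeta>\<close> is quadratic in \<open>\<beta> = (1 - \<alpha>) t\<close>, and it does not say that the orbit follows the
  digits of \<open>w\<close>. The signs at \<open>0\<close> and \<open>t\<close> exclude a second solution with other digits.\<close>

lemma upper_endpoint_unique:
  assumes "w \<noteq> []" "0 \<le> x" "x \<le> t" "0 \<le> y" "y \<le> t"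
    "moebius_act (wmat w) (Some (- x)) = Some (t - x)" "moebius_act (wmat w) (Some (- y)) = Some (t - y)"
  shows "x = y"
proof -
  obtain p q r u where m: "wmat w = mat2 p q (- r) (- u)" "q < p" "0 < q" "0 \<le> u"
    using wmat_entries[of w] assms(1) by blast
  have root: "r * z\<^sup>2 + (- p - t * r - u) * z + (q + t * u) = 0"
    if "moebius_act (wmat w) (Some (- z)) = Some (t - z)" for z
  proof -
    have "r * z - u \<noteq> 0" "(q - p * z) / (r * z - u) = t - z"
      using that by (auto simp: m moebius_act_mat2 split: if_splits)
    then have "q - p * z = (t - z) * (r * z - u)" by (simp add: field_simps)
    then show ?thesis by (simp add: algebra_simps power2_eq_square)
  qed
  have "0 \<le> t * u" using m t2 by simp
  moreover have "p * 1 \<le> p * t" using m t2 by (intro mult_left_mono) auto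
  moreover have "r * t\<^sup>2 + (- p - t * r - u) * t + (q + t * u) = q - p * t"
    by (simp add: algebra_simps power2_eq_square)
  ultimately have "r * t\<^sup>2 + (- p - t * r - u) * t + (q + t * u) < 0" "0 < q + t * u"
    using m by linarith+
  then show ?thesis using quadratic_root_unique[OF root[OF assms(6)] root[OF assms(7)] assms(2-5)] by simp
qed

text \<open>The matrix is \<open>C A\<^sup>-\<^sup>1 C\<close>. The equation in the definition of \<open>\<eta>\<close> is \<open>C A\<^sup>-\<^sup>1 C (-y) = C\<^sup>-\<^sup>1 (-x)\<close>
  with \<open>-x = \<ell>\<^sub>0\<close> and \<open>-y = L r\<^sub>0 = L A \<ell>\<^sub>0\<close>, and
  \<open>C\<^sup>-\<^sup>1\<close> maps \<open>-x\<close> to \<open>1 / (1 + x)\<close>.\<close>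

lemma lower_endpoint_iff:
  assumes "0 \<le> x"
  shows "moebius_act (mat2 (- t) (- 1) (1 - t) (- 1)) (Some (- y)) = Some (1 / (1 + x)) \<longleftrightarrow>
    y * (1 + t * x) = x"
proof -
  have x1: "1 + x \<noteq> 0" using assms by simp
  show ?thesis
  proof
    assume "moebius_act (mat2 (- t) (- 1) (1 - t) (- 1)) (Some (- y)) = Some (1 / (1 + x))"
    then have ne: "(t - 1) * y - 1 \<noteq> 0" and "(t * y - 1) / ((t - 1) * y - 1) = 1 / (1 + x)"
      by (auto simp: moebius_act_mat2 algebra_simps split: if_splits)
    then have "(t * y - 1) * (1 + x) = (t - 1) * y - 1" using x1 by (simp add: divide_eq_eq)
    then show "y * (1 + t * x) = x" by (simp add: algebra_simps)
  next
    assume eq: "y * (1 + t * x) = x"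
    then have e: "(t * y - 1) * (1 + x) = (t - 1) * y - 1" by (simp add: algebra_simps)
    have ne: "(t - 1) * y - 1 \<noteq> 0"
    proof
      assume "(t - 1) * y - 1 = 0"
      then have "t * y = 1" using e x1 by simp
      then have "y = 0" using \<open>(t - 1) * y - 1 = 0\<close> by (simp add: algebra_simps)
      then show False using \<open>t * y = 1\<close> by simp
    qed
    then have "(t * y - 1) / ((t - 1) * y - 1) = 1 / (1 + x)" using e x1 by (simp add: field_simps)
    then show "moebius_act (mat2 (- t) (- 1) (1 - t) (- 1)) (Some (- y)) = Some (1 / (1 + x))"
      using ne by (simp add: moebius_act_mat2 algebra_simps)
  qed
qed

lemma lower_endpoint_unique:
  assumes "w \<noteq> []" "0 \<le> x" "x \<le> t" "0 \<le> y" "y \<le> t"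
    "moebius_act (mat2 (- t) (- 1) (1 - t) (- 1) ** wmat w) (Some (- x)) = Some (1 / (1 + x))"
    "moebius_act (mat2 (- t) (- 1) (1 - t) (- 1) ** wmat w) (Some (- y)) = Some (1 / (1 + y))"
  shows "x = y"
proof -
  obtain p q r u where m: "wmat w = mat2 p q (- r) (- u)" "q < p" "0 < q" "0 \<le> u" "0 \<le> r" "u < q"
      "q - u \<le> p - r"
    using wmat_entries[of w] assms(1) by blast
  have root: "(r - p * t) * z\<^sup>2 + (q * t - p - u) * z + q = 0"
    if "moebius_act (mat2 (- t) (- 1) (1 - t) (- 1) ** wmat w) (Some (- z)) = Some (1 / (1 + z))" "0 \<le> z" for z
  proof -
    define A B where "A = q - p * z" and "B = r * z - u"
    have "(1 - t) * A - B \<noteq> 0" "(- t * A - B) / ((1 - t) * A - B) = 1 / (1 + z)"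
      using that(1) by (auto simp: m moebius_act_mat2 A_def B_def algebra_simps split: if_splits)
    then have "(- t * A - B) * (1 + z) = (1 - t) * A - B" using that(2) by (simp add: divide_eq_eq)
    then have "A + z * (t * A + B) = 0" by (simp add: algebra_simps)
    then show ?thesis by (simp add: A_def B_def algebra_simps power2_eq_square)
  qed
  have "(r - p * t) * t\<^sup>2 + (q * t - p - u) * t + q < 0"
  proof -
    have "r < p" using m by simp
    have "q * t \<le> p * t" using m t2 by (intro mult_right_mono) auto
    have "(r - p * t) * t\<^sup>2 \<le> (p - p * t) * t\<^sup>2"
      using \<open>r < p\<close> by (intro mult_right_mono) auto
    moreover have "q * t - p - u \<le> p * t - p" using m \<open>q * t \<le> p * t\<close> by linarith
    then have "(q * t - p - u) * t \<le> (p * t - p) * t" using t2 by (intro mult_right_mono) linarith+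
    ultimately have "(r - p * t) * t\<^sup>2 + (q * t - p - u) * t + q \<le> (p - p * t) * t\<^sup>2 + (p * t - p) * t + p"
      using m by linarith
    also have "\<dots> = p * (1 - t) + p * t\<^sup>2 * (2 - t)" by (simp add: algebra_simps power2_eq_square)
    also have "\<dots> < 0"
    proof -
      have "p * (1 - t) < 0" using m t2 by (simp add: mult_pos_neg)
      moreover have "p * t\<^sup>2 * (2 - t) \<le> 0" using m t2 by (intro mult_nonneg_nonpos) auto
      ultimately show ?thesis by simp
    qed
    finally show ?thesis .
  qed
  then show ?thesis
    using quadratic_root_unique[OF root[OF assms(6,2)] root[OF assms(7,4)] assms(2-5)] m by simp
qed

end

section \<open>Digits of the expansion\<close>

lemma tpar_ge_2:
  assumes "n \<ge> 3"
  shows "2 \<le> tpar n"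
proof -
  have "pi / real n \<le> pi / 3" using assms by (intro divide_left_mono) auto
  then have "cos (pi / 3) \<le> cos (pi / real n)" by (intro cos_monotone_0_pi_le) auto
  then show ?thesis by (simp add: tpar_def cos_60)
qed

text \<open>For a digit \<open>-j\<close> with \<open>j > 0\<close> the point \<open>C x\<close> lies to the right of \<open>[\<ell>\<^sub>0, r\<^sub>0)\<close>, so that automatically \<open>l = 1\<close>.\<close>

lemma digit_iff:
  assumes "n \<ge> 3" "0 < j"
  shows "digit n \<alpha> x = Some (- int j, 1) \<longleftrightarrow>
    x \<noteq> 0 \<and> ell0 n \<alpha> \<le> 1 - 1 / x - real j * tpar n \<and> 1 - 1 / x - real j * tpar n < r0 n \<alpha>"
proof -
  have t: "0 < tpar n" using tpar_ge_2[OF assms(1)] by simp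
  have C1: "mat_power matC 1 = matC" using mat_power_Suc[of matC 0] by (simp add: mat_power_0)
  have C: "moebius_act matC (Some x) = (if x = 0 then None else Some (1 - 1 / x))"
    by (auto simp: matC_mat2 moebius_act_mat2 field_simps)
  have fl: "\<lfloor>(1 - 1 / x) / tpar n + 1 - \<alpha>\<rfloor> = int j \<longleftrightarrow>
      ell0 n \<alpha> \<le> 1 - 1 / x - real j * tpar n \<and> 1 - 1 / x - real j * tpar n < r0 n \<alpha>"
  proof -
    define y where "y = 1 - 1 / x"
    have "real j \<le> y / tpar n + 1 - \<alpha> \<longleftrightarrow> real j - 1 + \<alpha> \<le> y / tpar n" by linarith
    also have "\<dots> \<longleftrightarrow> ell0 n \<alpha> \<le> y - real j * tpar n"
      using t by (simp only: pos_le_divide_eq ell0_def) (auto simp: algebra_simps)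
    finally have lower: "real j \<le> y / tpar n + 1 - \<alpha> \<longleftrightarrow> ell0 n \<alpha> \<le> y - real j * tpar n" .
    have "y / tpar n + 1 - \<alpha> < real j + 1 \<longleftrightarrow> y / tpar n < real j + \<alpha>" by linarith
    also have "\<dots> \<longleftrightarrow> y - real j * tpar n < r0 n \<alpha>"
      using t by (simp only: pos_divide_less_eq r0_def) (auto simp: algebra_simps)
    finally show ?thesis unfolding y_def[symmetric] floor_eq_iff using lower by simp
  qed
  show ?thesis
  proof
    assume d: "digit n \<alpha> x = Some (- int j, 1)"
    have l: "digit_l n \<alpha> x = 1"
      using d unfolding digit_def by (auto split: option.splits)
    then have "(if x = 0 then None else Some (1 - 1 / x)) \<noteq> None"
      using d unfolding digit_def l C1 C by (auto split: if_splits)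
    then have x: "x \<noteq> 0" by auto
    then have "\<lfloor>(1 - 1 / x) / tpar n + 1 - \<alpha>\<rfloor> = int j"
      using d unfolding digit_def l C1 C by simp
    then show "x \<noteq> 0 \<and> ell0 n \<alpha> \<le> 1 - 1 / x - real j * tpar n \<and> 1 - 1 / x - real j * tpar n < r0 n \<alpha>"
      using fl x by simp
  next
    assume r: "x \<noteq> 0 \<and> ell0 n \<alpha> \<le> 1 - 1 / x - real j * tpar n \<and> 1 - 1 / x - real j * tpar n < r0 n \<alpha>"
    have "tpar n \<le> real j * tpar n" using assms t by simp
    moreover have "ell0 n \<alpha> = r0 n \<alpha> - tpar n" by (simp add: ell0_def r0_def algebra_simps)
    ultimately have "r0 n \<alpha> \<le> 1 - 1 / x" using r by linarith
    then have "moebius_act (mat_power matC 1) (Some x) \<notin> Some ` dom_int n \<alpha>"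
      unfolding C1 C using r by (auto simp: dom_int_def)
    then have l: "digit_l n \<alpha> x = 1" unfolding digit_l_def by (intro Least_equality) auto
    show "digit n \<alpha> x = Some (- int j, 1)" unfolding digit_def l C1 C using r fl by simp
  qed
qed

lemma Tmap_digit:
  assumes "digit n \<alpha> x = Some (- int j, 1)" "x \<noteq> 0"
  shows "Tmap n \<alpha> x = Some (1 - 1 / x - real j * tpar n)"
proof -
  have C1: "mat_power matC 1 = matC" using mat_power_Suc[of matC 0] by (simp add: mat_power_0)
  show ?thesis unfolding Tmap_def assms(1) option.case prod.case C1 digit_matrix
    using assms(2) by (simp add: moebius_act_mat2 field_simps)
qed

lemma orbit_Suc_first: "orbit n \<alpha> x (Suc i) = Option.bind (Tmap n \<alpha> x) (\<lambda>y. orbit n \<alpha> y i)"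
  by (induction i) simp_all

lemma digit_seq_0: "digit_seq n \<alpha> x 0 = digit n \<alpha> x"
  by (simp add: digit_seq_def)

lemma digit_seq_Suc: "digit_seq n \<alpha> x (Suc i) = Option.bind (Tmap n \<alpha> x) (\<lambda>y. digit_seq n \<alpha> y i)"
  by (simp only: digit_seq_def orbit_Suc_first Option.bind_assoc)

locale expansion =
  fixes n k :: nat
  assumes n3: "3 \<le> n" and k2: "2 \<le> k"

sublocale expansion \<subseteq> inverse_branches "tpar n" "real k * tpar n - 1"
proof
  show t: "2 \<le> tpar n" by (rule tpar_ge_2[OF n3])
  have "2 * tpar n \<le> real k * tpar n" using k2 t by (intro mult_right_mono) auto
  then show "2 * tpar n - 1 \<le> real k * tpar n - 1" by simp
qed

context expansion
begin

abbreviation digit_val :: "bool \<Rightarrow> int" where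
  "digit_val c \<equiv> - int (if c then Suc k else k)"

lemma d_lower_enc: "d_lower k v = map digit_val (enc False v)"
  by (induction k v rule: d_lower.induct) (simp_all add: map_replicate)

lemma LA_mat_enc: "LA_mat n k v = wmat (enc False v)"
proof -
  have rep: "wmat (replicate e c @ w) = wmat w **
      mat_power (mat_int_power (matA n) (digit_val c) ** matC) e" for e c w
  proof (induction e)
    case 0
    show ?case by (simp add: mat_power_0)
  next
    case (Suc e)
    have "mat2 (if c then (real k * tpar n - 1) + tpar n else real k * tpar n - 1) 1 (-1) 0
      = mat_int_power (matA n) (digit_val c) ** matC"
      unfolding digit_matrix by (simp add: algebra_simps)
    then show ?case using Suc
      by (simp only: replicate_Suc append_Cons wmat.simps mat_power_Suc_right matrix_mul_assoc)
  qed
  have LA: "LA_mat n k [c] = mat_power (mat_int_power (matA n) (digit_val False) ** matC) c"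
    "LA_mat n k (c # d # w) = LA_mat n k w **
      mat_power (mat_int_power (matA n) (digit_val True) ** matC) d **
      mat_power (mat_int_power (matA n) (digit_val False) ** matC) c" for c d w
  proof -
    have "- int (Suc k) = - int k - 1" by simp
    then show "LA_mat n k [c] = mat_power (mat_int_power (matA n) (digit_val False) ** matC) c"
      "LA_mat n k (c # d # w) = LA_mat n k w **
        mat_power (mat_int_power (matA n) (digit_val True) ** matC) d **
        mat_power (mat_int_power (matA n) (digit_val False) ** matC) c"
      by (simp_all only: LA_mat.simps if_True if_False)
  qed
  have rep0: "wmat (replicate e c) = mat_power (mat_int_power (matA n) (digit_val c) ** matC) e" for e c
    using rep[of e c "[]"] by simp
  show ?thesis
    by (induction v rule: induct_list012)
      (simp_all only: LA_mat.simps(1) LA enc.simps rep rep0 wmat.simps append_Nil2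
        not_True_eq_False not_False_eq_True)
qed

text \<open>One step of the orbit inverts \<open>br [c]\<close>, and the digit is the condition on the image. The case \<open>x = 0\<close>, in which
  the orbit stops, cannot occur on the right because \<open>br [c] y \<noteq> 0\<close>.\<close>

lemma digit_step_iff:
  assumes "\<alpha> \<le> 1" "0 \<le> \<alpha>" and \<beta>: "\<beta> = (1 - \<alpha>) * tpar n"
  shows "digit n \<alpha> (- x) = Some (digit_val c, 1) \<and> Tmap n \<alpha> (- x) = Some (- y) \<longleftrightarrow>
    x = br [c] y \<and> \<beta> - tpar n < y \<and> y \<le> \<beta>"
proof -
  let ?j = "if c then Suc k else k"
  define sc where "sc = real ?j * tpar n - 1"
  have "sc = (if c then real k * tpar n - 1 + tpar n else real k * tpar n - 1)"
    by (simp add: sc_def algebra_simps)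
  then have br: "br [c] y = 1 / (sc - y)" by simp
  have "2 * tpar n - 1 \<le> sc" using s_ge t2 by (auto simp: sc_def algebra_simps)
  moreover have "\<beta> \<le> tpar n" using assms t2 by (simp add: mult_le_cancel_right1)
  ultimately have sc: "y < sc" if "y \<le> \<beta>" for y using that t2 by simp
  have j: "?j > 0" using k2 by simp
  have digit: "digit n \<alpha> (- x) = Some (digit_val c, 1) \<longleftrightarrow> x \<noteq> 0 \<and> \<beta> - tpar n < sc - 1 / x \<and> sc - 1 / x \<le> \<beta>"
    unfolding digit_iff[OF n3 j] ell0_def r0_def sc_def \<beta> by (auto simp: algebra_simps)
  have T: "Tmap n \<alpha> (- x) = Some (- (sc - 1 / x))"
    if "digit n \<alpha> (- x) = Some (digit_val c, 1)" "x \<noteq> 0"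
    using Tmap_digit[OF that(1)] that(2) by (simp add: sc_def algebra_simps)
  show ?thesis
  proof
    assume l: "digit n \<alpha> (- x) = Some (digit_val c, 1) \<and> Tmap n \<alpha> (- x) = Some (- y)"
    then have x: "x \<noteq> 0" "\<beta> - tpar n < sc - 1 / x" "sc - 1 / x \<le> \<beta>" using digit by auto
    then have "y = sc - 1 / x" using l T by simp
    then show "x = br [c] y \<and> \<beta> - tpar n < y \<and> y \<le> \<beta>" using x br by simp
  next
    assume r: "x = br [c] y \<and> \<beta> - tpar n < y \<and> y \<le> \<beta>"
    then have "x \<noteq> 0" "y = sc - 1 / x" using br sc[of y] by auto
    then show "digit n \<alpha> (- x) = Some (digit_val c, 1) \<and> Tmap n \<alpha> (- x) = Some (- y)"
      using digit T r by metis
  qed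
qed

lemma digit_Tmap_defined:
  assumes "digit n \<alpha> (- x) = Some (digit_val c, 1)"
  obtains y where "Tmap n \<alpha> (- x) = Some (- y)"
proof -
  have "x \<noteq> 0" using assms k2 digit_iff[OF n3, of "if c then Suc k else k" \<alpha> "- x"] by simp
  then show thesis using Tmap_digit[OF assms] that[of "- (1 - 1 / (- x) - real (if c then Suc k else k) * tpar n)"] by simp
qed

lemma digit_seq_iff:
  assumes "\<alpha> \<le> 1" "0 \<le> \<alpha>" and \<beta>: "\<beta> = (1 - \<alpha>) * tpar n"
  shows "(\<forall>i<length w. digit_seq n \<alpha> (- x) i = Some (digit_val (w ! i), 1)) \<longleftrightarrow>
    (\<exists>y. x = br w y \<and> (\<forall>Q. strict_suffix Q w \<longrightarrow> \<beta> - tpar n < br Q y \<and> br Q y \<le> \<beta>))"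
proof (induction w arbitrary: x)
  case Nil
  show ?case by simp
next
  case (Cons c w)
  have suf: "strict_suffix Q (c # w) \<longleftrightarrow> Q = w \<or> strict_suffix Q w" for Q
    by (auto simp: strict_suffix_def suffix_Cons dest: suffix_length_le)
  have br: "br (c # w) y = br [c] (br w y)" for y by simp
  have "(\<forall>i<length (c # w). digit_seq n \<alpha> (- x) i = Some (digit_val ((c # w) ! i), 1)) \<longleftrightarrow>
    digit n \<alpha> (- x) = Some (digit_val c, 1) \<and>
    (\<forall>i<length w. Option.bind (Tmap n \<alpha> (- x)) (\<lambda>y. digit_seq n \<alpha> y i) = Some (digit_val (w ! i), 1))"
    by (simp only: length_Cons All_less_Suc2 digit_seq_0 digit_seq_Suc nth_Cons_0 nth_Cons_Suc)
  also have "\<dots> \<longleftrightarrow> (\<exists>y. (digit n \<alpha> (- x) = Some (digit_val c, 1) \<and> Tmap n \<alpha> (- x) = Some (- y)) \<and>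
    (\<forall>i<length w. digit_seq n \<alpha> (- y) i = Some (digit_val (w ! i), 1)))"
  proof (cases "digit n \<alpha> (- x) = Some (digit_val c, 1)")
    case True
    from True obtain y where y: "Tmap n \<alpha> (- x) = Some (- y)" by (rule digit_Tmap_defined)
    show ?thesis unfolding y Option.bind.simps(2) True by simp
  next
    case False
    then show ?thesis by blast
  qed
  also have "\<dots> \<longleftrightarrow> (\<exists>z. x = br (c # w) z \<and>
      (\<forall>Q. strict_suffix Q (c # w) \<longrightarrow> \<beta> - tpar n < br Q z \<and> br Q z \<le> \<beta>))"
    unfolding digit_step_iff[OF assms] Cons.IH suf br by blast
  finally show ?case .
qed

lemma I_cyl_iff: "\<alpha> \<in> I_cyl n k v \<longleftrightarrow> 0 \<le> \<alpha> \<and> \<alpha> \<le> 1 \<and> cyl (enc False v) ((1 - \<alpha>) * tpar n)"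
proof (cases "0 \<le> \<alpha> \<and> \<alpha> \<le> 1")
  case True
  have e: "ell0 n \<alpha> = - ((1 - \<alpha>) * tpar n)" by (simp add: ell0_def algebra_simps)
  have map: "(\<forall>i<length (map f w). D i = Some (map f w ! i, 1)) \<longleftrightarrow> (\<forall>i<length w. D i = Some (f (w ! i), 1))"
    for D :: "nat \<Rightarrow> (int \<times> nat) option" and f :: "bool \<Rightarrow> int" and w
    by auto
  have "(\<forall>i<length (enc False v). digit_seq n \<alpha> (- ((1 - \<alpha>) * tpar n)) i =
      Some (digit_val (enc False v ! i), 1)) \<longleftrightarrow> cyl (enc False v) ((1 - \<alpha>) * tpar n)"
    unfolding cyl_def by (rule digit_seq_iff[OF _ _ refl]) (use True in auto)
  then show ?thesis
    unfolding I_cyl_def d_lower_enc mem_Collect_eq e map using True by blast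
next
  case False
  then show ?thesis unfolding I_cyl_def by blast
qed

section \<open>The parameter intervals\<close>

lemma param_eq:
  assumes "b = (1 - \<alpha>) * tpar n"
  shows "\<alpha> = 1 - b / tpar n" "ell0 n \<alpha> = - b" "r0 n \<alpha> = tpar n - b"
proof -
  have "b / tpar n = 1 - \<alpha>" unfolding assms using t2 by simp
  then show "\<alpha> = 1 - b / tpar n" by simp
  show "ell0 n \<alpha> = - b" "r0 n \<alpha> = tpar n - b"
    unfolding assms ell0_def r0_def by (simp_all add: left_diff_distrib)
qed

lemma param_range:
  "0 \<le> \<alpha> \<and> \<alpha> \<le> 1 \<longleftrightarrow> 0 \<le> (1 - \<alpha>) * tpar n \<and> (1 - \<alpha>) * tpar n \<le> tpar n"
proof -
  have t: "0 < tpar n" using t2 by simp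
  then have "(1 - \<alpha>) * tpar n \<le> 1 * tpar n \<longleftrightarrow> 0 \<le> \<alpha>"
    unfolding mult_le_cancel_right by linarith
  then have "(1 - \<alpha>) * tpar n \<le> tpar n \<longleftrightarrow> 0 \<le> \<alpha>" by (simp only: mult_1_left)
  moreover have "0 \<le> (1 - \<alpha>) * tpar n \<longleftrightarrow> \<alpha> \<le> 1"
    using t unfolding zero_le_mult_iff by linarith
  ultimately show ?thesis by blast
qed

lemma the_param_eq:
  assumes "0 \<le> b" "b \<le> tpar n" "Q b" "\<And>x. 0 \<le> x \<Longrightarrow> x \<le> tpar n \<Longrightarrow> Q x \<Longrightarrow> x = b"
  shows "(THE \<alpha>. 0 \<le> \<alpha> \<and> \<alpha> \<le> 1 \<and> Q ((1 - \<alpha>) * tpar n)) = 1 - b / tpar n"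
proof (rule the_equality)
  have b: "(1 - (1 - b / tpar n)) * tpar n = b" using t2 by simp
  show "0 \<le> 1 - b / tpar n \<and> 1 - b / tpar n \<le> 1 \<and> Q ((1 - (1 - b / tpar n)) * tpar n)"
    unfolding b using param_range[of "1 - b / tpar n", unfolded b] assms(1-3) by blast
next
  fix \<alpha> assume "0 \<le> \<alpha> \<and> \<alpha> \<le> 1 \<and> Q ((1 - \<alpha>) * tpar n)"
  then have "b = (1 - \<alpha>) * tpar n" using param_range[of \<alpha>] assms(4)[of "(1 - \<alpha>) * tpar n"] by metis
  then show "\<alpha> = 1 - b / tpar n" by (rule param_eq(1))
qed

text \<open>The fixed point is a solution since \<open>L A\<close> maps \<open>\<ell>\<^sub>0 = -b\<close> to \<open>t - b = r\<^sub>0\<close>.\<close>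

lemma zeta_eq:
  assumes "enc False v = w" "w \<noteq> []" "0 < b" "b < 1" "br w (b - tpar n) = b"
  shows "zeta n k v = 1 - b / tpar n"
proof -
  have "matrix_inv (matA n) ** matA n = mat 1"
    unfolding inv_matA unfolding matA_mat2 mat_1_mat2 by simp
  then have M: "L_mat n k v ** matA n = wmat w"
    unfolding L_mat_def LA_mat_enc assms(1) matrix_mul_assoc[symmetric] by simp
  define Q where "Q x \<longleftrightarrow> moebius_act (wmat w) (Some (- x)) = Some (tpar n - x)" for x
  have "zeta n k v = (THE \<alpha>. 0 \<le> \<alpha> \<and> \<alpha> \<le> 1 \<and> Q ((1 - \<alpha>) * tpar n))"
    unfolding zeta_def M Q_def using param_eq(2,3) by simp
  also have "\<dots> = 1 - b / tpar n"
  proof (rule the_param_eq)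
    have "b - tpar n < 1" using assms t2 by simp
    then show "Q b" using wmat_act[of "b - tpar n" w] assms(5) by (simp add: Q_def)
    then show "x = b" if "0 \<le> x" "x \<le> tpar n" "Q x" for x
      using that upper_endpoint_unique[OF assms(2), of x b] assms t2 by (simp add: Q_def)
  qed (use assms t2 in auto)
  finally show ?thesis .
qed

lemma eta_eq:
  assumes "enc False v = w" "w \<noteq> []" "0 < b" "b < 1" "br w (b / (1 + tpar n * b)) = b"
  shows "eta n k v = 1 - b / tpar n"
proof -
  let ?G = "mat2 (- tpar n) (- 1) (1 - tpar n) (- 1)"
  have G: "matC ** mat2 1 (- tpar n) 0 1 ** matC = ?G"
    by (simp add: matC_mat2)
  have M: "moebius_act (?G ** (wmat w ** mat2 1 (- tpar n) 0 1)) (Some x) =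
      moebius_act (?G ** wmat w) (Some (x - tpar n))" for x
    unfolding matrix_mul_assoc by (subst moebius_act_compose) simp_all
  have C: "moebius_act (mat2 0 (-1) 1 (-1)) (Some (- x)) = Some (1 / (1 + x))" if "0 \<le> x" for x
  proof -
    have den: "1 * - x + - 1 = - (1 + x)" "0 * - x + - 1 = - (1::real)" by simp_all
    have "- (1 + x) \<noteq> 0" using that by simp
    then show ?thesis unfolding moebius_act_mat2 den minus_divide_divide by (simp only: if_False)
  qed
  define Q where "Q x \<longleftrightarrow> moebius_act (?G ** wmat w) (Some (- x)) = Some (1 / (1 + x))" for x
  have eq: "moebius_act (?G ** (wmat w ** mat2 1 (- tpar n) 0 1)) (Some (r0 n \<alpha>)) =
      moebius_act (mat2 0 (-1) 1 (-1)) (Some (ell0 n \<alpha>)) \<longleftrightarrow> Q ((1 - \<alpha>) * tpar n)"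
    if "0 \<le> \<alpha> \<and> \<alpha> \<le> 1" for \<alpha>
  proof -
    define x where "x = (1 - \<alpha>) * tpar n"
    have "0 \<le> x" using that param_range unfolding x_def by blast
    moreover have "r0 n \<alpha> - tpar n = - x" unfolding param_eq(3)[OF x_def] by simp
    ultimately show ?thesis unfolding M Q_def x_def[symmetric] param_eq(2)[OF x_def] by (simp only: C)
  qed
  have "eta n k v = (THE \<alpha>. 0 \<le> \<alpha> \<and> \<alpha> \<le> 1 \<and> Q ((1 - \<alpha>) * tpar n))"
    unfolding eta_def L_mat_def LA_mat_enc assms(1) inv_matA inv_matC G
    by (intro arg_cong[where f = The] ext conj_cong refl eq conjI)
  also have "\<dots> = 1 - b / tpar n"
  proof (rule the_param_eq)
    have den: "1 + tpar n * b > 0" using assms(3) t2 by (simp add: add_pos_pos)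
    define y where "y = b / (1 + tpar n * b)"
    have yb: "y * (1 + tpar n * b) = b" using den by (simp add: y_def)
    have "b \<le> tpar n * b" using assms t2 by simp
    then have y: "y < 1" unfolding y_def using den by simp
    obtain p q r u where m: "wmat w = mat2 p q r u" using wmat_entries[of w] by blast
    have "moebius_act (mat2 p q r u) (Some (- b)) = Some (- y)"
      using wmat_act[OF y, of w] assms(5) by (simp only: y_def[symmetric] m)
    then have "r * - b + u \<noteq> 0" "(p * - b + q) / (r * - b + u) = - y"
      unfolding moebius_act_mat2 by (simp_all only: option.distinct option.inject simp_thms split: if_splits)
    then have "moebius_act (?G ** wmat w) (Some (- b)) = moebius_act ?G (Some (- y))"
      unfolding m using moebius_act_compose[of r "- b" u ?G p q] by metis
    then show "Q b" unfolding Q_def using lower_endpoint_iff[of b y] yb assms(3) by simp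
    then show "x = b" if "0 \<le> x" "x \<le> tpar n" "Q x" for x
      using that lower_endpoint_unique[OF assms(2), of x b] assms t2 by (simp add: Q_def)
  qed (use assms t2 in auto)
  finally show ?thesis .
qed

lemma J_int_iff:
  assumes "enc False v = low U P"
  shows "\<alpha> \<in> J_int n k v \<longleftrightarrow> 0 \<le> \<alpha> \<and> \<alpha> \<le> 1 \<and> sync U P ((1 - \<alpha>) * tpar n)"
proof -
  obtain bz be where b: "0 < bz" "bz < 1" "br (low U P) (bz - tpar n) = bz"
    "0 < be" "be < 1" "br (low U P) (be / (1 + tpar n * be)) = be"
    "\<And>\<beta>. 0 \<le> \<beta> \<Longrightarrow> \<beta> \<le> tpar n \<Longrightarrow> sync U P \<beta> \<longleftrightarrow> bz < \<beta> \<and> \<beta> \<le> be"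
    using sync_interval[of U P] by metis
  have w: "low U P \<noteq> []" by (simp add: low_def)
  have "\<alpha> \<in> J_int n k v \<longleftrightarrow> 1 - be / tpar n \<le> \<alpha> \<and> \<alpha> < 1 - bz / tpar n"
    using zeta_eq[OF assms w b(1-3)] eta_eq[OF assms w b(4-6)] by (simp add: J_int_def)
  also have "\<dots> \<longleftrightarrow> bz < (1 - \<alpha>) * tpar n \<and> (1 - \<alpha>) * tpar n \<le> be"
    using t2 by (auto simp: field_simps)
  also have "\<dots> \<longleftrightarrow> (0 \<le> \<alpha> \<and> \<alpha> \<le> 1) \<and> bz < (1 - \<alpha>) * tpar n \<and> (1 - \<alpha>) * tpar n \<le> be"
  proof -
    have "0 \<le> \<alpha> \<and> \<alpha> \<le> 1" if "bz < (1 - \<alpha>) * tpar n" "(1 - \<alpha>) * tpar n \<le> be"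
      unfolding param_range using that b(1,5) t2 by linarith
    then show ?thesis by blast
  qed
  also have "\<dots> \<longleftrightarrow> (0 \<le> \<alpha> \<and> \<alpha> \<le> 1) \<and> sync U P ((1 - \<alpha>) * tpar n)"
    using b(7) param_range by blast
  finally show ?thesis by simp
qed

theorem I_cyl_partition:
  assumes "v \<in> Vwords"
  shows "I_cyl n k v = J_int n k v \<union> (\<Union>q\<in>Theta_index v. I_cyl n k (Theta q v))"
    and "disjoint_family_on (\<lambda>q. I_cyl n k (Theta q v)) (Theta_index v)"
    and "\<forall>q\<in>Theta_index v. J_int n k v \<inter> I_cyl n k (Theta q v) = {}"
proof -
  obtain U P where UP: "node U P" "enc False v = low U P" using Vwords_node[OF assms] .
  let ?child = "\<lambda>m. low (low U P) (wpow (high U P) m @ P)"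
  have v0: "v \<noteq> []" using Vwords_is_word[OF assms] by (auto simp: is_word_def)
  have child: "enc False (Theta q v) = ?child (child_index v q)" if "q \<in> Theta_index v" for q
    using enc_Theta[OF assms that UP] .
  note bij = child_index_bij[OF v0]
  have "\<alpha> \<in> I_cyl n k v \<longleftrightarrow> \<alpha> \<in> J_int n k v \<or> (\<exists>q\<in>Theta_index v. \<alpha> \<in> I_cyl n k (Theta q v))" for \<alpha>
  proof -
    have "(\<exists>m. cyl (?child m) ((1 - \<alpha>) * tpar n)) \<longleftrightarrow>
      (\<exists>q\<in>Theta_index v. cyl (?child (child_index v q)) ((1 - \<alpha>) * tpar n))"
      using bij by (metis bij_betw_imp_surj_on imageE rangeI)
    then show ?thesis
      unfolding I_cyl_iff J_int_iff[OF UP(2)] UP(2)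
      using cyl_partition[OF UP(1), of "(1 - \<alpha>) * tpar n"] param_range[of \<alpha>] child by auto
  qed
  then show "I_cyl n k v = J_int n k v \<union> (\<Union>q\<in>Theta_index v. I_cyl n k (Theta q v))" by blast
  show "\<forall>q\<in>Theta_index v. J_int n k v \<inter> I_cyl n k (Theta q v) = {}"
  proof (intro ballI equals0I)
    fix q \<alpha> assume q: "q \<in> Theta_index v" and "\<alpha> \<in> J_int n k v \<inter> I_cyl n k (Theta q v)"
    then have "0 \<le> \<alpha> \<and> \<alpha> \<le> 1" "sync U P ((1 - \<alpha>) * tpar n)"
      "cyl (?child (child_index v q)) ((1 - \<alpha>) * tpar n)"
      by (simp_all add: I_cyl_iff J_int_iff[OF UP(2)] child[OF q])
    then show False using sync_not_child[OF UP(1)] param_range by blast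
  qed
  show "disjoint_family_on (\<lambda>q. I_cyl n k (Theta q v)) (Theta_index v)"
  proof -
    have "child_index v q = child_index v q'"
      if q: "q \<in> Theta_index v" "q' \<in> Theta_index v" and
        \<alpha>: "\<alpha> \<in> I_cyl n k (Theta q v)" "\<alpha> \<in> I_cyl n k (Theta q' v)" for q q' \<alpha>
    proof (rule ccontr)
      assume ne: "child_index v q \<noteq> child_index v q'"
      have "cyl (?child (child_index v q)) ((1 - \<alpha>) * tpar n)" 
        "cyl (?child (child_index v q')) ((1 - \<alpha>) * tpar n)" "(1 - \<alpha>) * tpar n \<le> tpar n"
        using \<alpha> child q param_range by (auto simp: I_cyl_iff)
      then show False using children_disjoint[OF UP(1)] ne by (metis linorder_neqE_nat)
    qed
    then show ?thesis
      using bij_betw_imp_inj_on[OF bij] unfolding disjoint_family_on_def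
      by (metis (no_types, lifting) disjoint_iff inj_onD)
  qed
qed

end

section \<open>First digits\<close>

text \<open>With \<open>\<beta> = (1 - \<alpha>) t\<close> the first digit of \<open>\<ell>\<^sub>0\<close> is \<open>-k\<close> iff \<open>k t \<le> \<beta> + 1 / \<beta> + 1 < (k + 1) t\<close>.\<close>

lemma one_letter_cyl_iff:
  assumes "3 \<le> n" "2 \<le> k"
  shows "\<alpha> \<in> I_cyl n k [1] \<longleftrightarrow> 0 \<le> \<alpha> \<and> \<alpha> < 1 \<and>
    \<lfloor>((1 - \<alpha>) * tpar n + 1 / ((1 - \<alpha>) * tpar n) + 1) / tpar n\<rfloor> = int k"
proof -
  have t: "0 < tpar n" using tpar_ge_2[OF assms(1)] by simp
  have e: "ell0 n \<alpha> = - ((1 - \<alpha>) * tpar n)" by (simp add: ell0_def algebra_simps)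
  define b where "b = (1 - \<alpha>) * tpar n"
  have r: "r0 n \<alpha> = tpar n - b" by (simp add: r0_def b_def algebra_simps)
  have "\<alpha> \<in> I_cyl n k [1] \<longleftrightarrow> 0 \<le> \<alpha> \<and> \<alpha> \<le> 1 \<and> digit n \<alpha> (- b) = Some (- int k, 1)"
    by (simp add: I_cyl_def digit_seq_0 e b_def)
  also have "digit n \<alpha> (- b) = Some (- int k, 1) \<longleftrightarrow> b \<noteq> 0 \<and>
      real k * tpar n \<le> b + 1 / b + 1 \<and> b + 1 / b + 1 < (real k + 1) * tpar n"
  proof -
    have k: "0 < k" using assms(2) by simp
    have e': "ell0 n \<alpha> = - b" unfolding e b_def ..
    have "- b \<le> 1 - - (1 / b) - real k * tpar n \<longleftrightarrow> real k * tpar n \<le> b + 1 / b + 1"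
      "1 - - (1 / b) - real k * tpar n < tpar n - b \<longleftrightarrow> b + 1 / b + 1 < real k * tpar n + tpar n"
      by linarith+
    then show ?thesis
      unfolding digit_iff[OF assms(1) k] e' r divide_minus_right neg_equal_0_iff_equal
      by (simp only: distrib_right mult_1_left)
  qed
  also have "\<dots> \<longleftrightarrow> b \<noteq> 0 \<and> \<lfloor>(b + 1 / b + 1) / tpar n\<rfloor> = int k"
    unfolding floor_eq_iff pos_le_divide_eq[OF t] pos_divide_less_eq[OF t] by simp
  also have "0 \<le> \<alpha> \<and> \<alpha> \<le> 1 \<and> b \<noteq> 0 \<and> \<lfloor>(b + 1 / b + 1) / tpar n\<rfloor> = int k \<longleftrightarrow>
      0 \<le> \<alpha> \<and> \<alpha> < 1 \<and> \<lfloor>(b + 1 / b + 1) / tpar n\<rfloor> = int k"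
  proof -
    have "b \<noteq> 0 \<longleftrightarrow> \<alpha> \<noteq> 1" using t by (simp add: b_def)
    then show ?thesis by linarith
  qed
  finally show ?thesis by (simp add: b_def)
qed

text \<open>The equation for \<open>\<epsilon>\<close> reads \<open>\<beta>\<^sup>2 - (2 t - 1) \<beta> + 1 = 0\<close>. The product of its roots is \<open>1\<close>, and as the quadratic
  is negative at \<open>t\<close>, only the smaller root is below \<open>t\<close>.\<close>

lemma eps_bound_iff:
  assumes "3 \<le> n"
  shows "eps n \<le> \<alpha> \<and> \<alpha> < 1 \<longleftrightarrow> 0 \<le> \<alpha> \<and> \<alpha> < 1 \<and>
    2 * tpar n \<le> (1 - \<alpha>) * tpar n + 1 / ((1 - \<alpha>) * tpar n) + 1"
proof -
  define t where "t = tpar n"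
  have t: "2 \<le> t" using tpar_ge_2[OF assms] by (simp add: t_def)
  define f where "f x = x\<^sup>2 + (1 - 2 * t) * x + 1" for x
  have ft: "f t < 0"
  proof -
    have "0 < t * (t - 1) - 1" using mult_mono[of 2 t 1 "t - 1"] t by simp
    then show ?thesis by (simp add: f_def algebra_simps power2_eq_square)
  qed
  have "\<exists>x\<ge>0. x \<le> t \<and> f x = 0"
    using ft t unfolding f_def by (intro IVT2') (auto intro!: continuous_intros)
  then obtain b where b: "0 \<le> b" "b \<le> t" "f b = 0" by blast
  then have b0: "0 < b" "b < t" using ft by (auto simp: f_def less_le)
  define c where "c = 1 / b"
  have bc: "b * c = 1" using b0 by (simp add: c_def)
  have factor: "f x = (x - b) * (x - c)" for x
  proof -
    have "(2 * t - 1) * b = b\<^sup>2 + 1" using b(3) by (simp add: f_def algebra_simps)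
    also have "\<dots> = (b + c) * b" using bc by (simp add: algebra_simps power2_eq_square)
    finally have "2 * t - 1 = b + c" using b0 by simp
    then have eq: "1 - 2 * t = - (b + c)" by simp
    have "f x = x\<^sup>2 + - (b + c) * x + b * c" unfolding f_def bc eq ..
    then show ?thesis by (simp add: algebra_simps power2_eq_square)
  qed
  have "t < c" using ft b0 unfolding factor by (simp add: mult_less_0_iff)
  then have sign: "0 \<le> f x \<longleftrightarrow> x \<le> b" if "x \<le> t" for x
    using that unfolding factor zero_le_mult_iff by linarith
  have zero: "f x = 0 \<longleftrightarrow> x = b" if "x < t" for x
    using that \<open>t < c\<close> unfolding factor mult_eq_0_iff by linarith
  have M: "mat_int_power (matA n) (-1) ** matC = mat2 (t - 1) 1 (-1) 0"
    using digit_matrix[of n 1] by (simp only: t_def of_nat_1 mult_1_left)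
  have act: "moebius_act (mat2 (t - 1) 1 (-1) 0) (Some (- x)) = Some (t - x) \<longleftrightarrow> f x = 0" if "0 < x" for x
  proof -
    have "moebius_act (mat2 (t - 1) 1 (-1) 0) (Some (- x)) = Some (((t - 1) * - x + 1) / x)"
      using that by (simp add: moebius_act_mat2)
    moreover have "((t - 1) * - x + 1) / x = t - x \<longleftrightarrow> (t - 1) * - x + 1 = (t - x) * x"
      using that by (simp add: divide_eq_eq)
    moreover have "\<dots> \<longleftrightarrow> f x = 0" by (auto simp: f_def algebra_simps power2_eq_square)
    ultimately show ?thesis by simp
  qed
  have "eps n = 1 - b / t"
    unfolding eps_def M
  proof (rule the_equality)
    have "ell0 n (1 - b / t) = - b" "r0 n (1 - b / t) = t - b"
      using t by (simp_all add: ell0_def r0_def t_def[symmetric] left_diff_distrib)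
    moreover have "0 < 1 - b / t \<and> 1 - b / t < 1" using b0 t by simp
    ultimately show "0 < 1 - b / t \<and> 1 - b / t < 1 \<and>
      moebius_act (mat2 (t - 1) 1 (-1) 0) (Some (ell0 n (1 - b / t))) = Some (r0 n (1 - b / t))"
      using act[OF b0(1)] b(3) by simp
  next
    fix \<alpha> assume \<alpha>: "0 < \<alpha> \<and> \<alpha> < 1 \<and>
      moebius_act (mat2 (t - 1) 1 (-1) 0) (Some (ell0 n \<alpha>)) = Some (r0 n \<alpha>)"
    define x where "x = (1 - \<alpha>) * t"
    have x: "0 < x" "x < t" using \<alpha> t by (auto simp: x_def)
    have "ell0 n \<alpha> = - x" "r0 n \<alpha> = t - x"
      by (simp_all add: x_def ell0_def r0_def t_def left_diff_distrib)
    then have "x = b" using \<alpha> act[OF x(1)] zero[OF x(2)] by simp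
    then have "b / t = 1 - \<alpha>" using t unfolding x_def by auto
    then show "\<alpha> = 1 - b / t" by simp
  qed
  then have "eps n \<le> \<alpha> \<longleftrightarrow> 1 - \<alpha> \<le> b / t" by linarith
  then have eps: "eps n \<le> \<alpha> \<longleftrightarrow> (1 - \<alpha>) * t \<le> b" using t by (simp add: pos_le_divide_eq)
  define x where "x = (1 - \<alpha>) * t"
  have x1: "\<alpha> < 1 \<longleftrightarrow> 0 < x" "0 \<le> \<alpha> \<longleftrightarrow> x \<le> t"
  proof -
    show "\<alpha> < 1 \<longleftrightarrow> 0 < x" using t by (simp add: x_def zero_less_mult_iff)
    have "x \<le> 1 * t \<longleftrightarrow> 0 \<le> \<alpha>" unfolding x_def mult_le_cancel_right using t by linarith
    then show "0 \<le> \<alpha> \<longleftrightarrow> x \<le> t" by simp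
  qed
  have "0 \<le> f x \<longleftrightarrow> 2 * t \<le> x + 1 / x + 1" if "0 < x"
  proof -
    have "f x = (x + 1 / x + 1 - 2 * t) * x" using that by (simp add: f_def algebra_simps power2_eq_square)
    then show ?thesis using that by (simp add: zero_le_mult_iff)
  qed
  then have "x \<le> b \<and> 0 < x \<longleftrightarrow> x \<le> t \<and> 0 < x \<and> 2 * t \<le> x + 1 / x + 1"
    using sign[of x] b by auto
  then show ?thesis unfolding eps t_def[symmetric] x_def[symmetric] x1 .
qed

theorem theorem54:
  fixes n :: nat
  assumes "n \<ge> 3"
  shows "{eps n..<1} = (\<Union>k\<in>{2..}. I_cyl n k [1])
    \<and> disjoint_family_on (\<lambda>k. I_cyl n k [1]) {2..}
    \<and> (\<forall>k\<ge>2. \<forall>v\<in>Vwords.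
          I_cyl n k v = J_int n k v \<union> (\<Union>q\<in>Theta_index v. I_cyl n k (Theta q v))
        \<and> disjoint_family_on (\<lambda>q. I_cyl n k (Theta q v)) (Theta_index v)
        \<and> (\<forall>q\<in>Theta_index v. J_int n k v \<inter> I_cyl n k (Theta q v) = {}))"
proof (intro conjI allI impI ballI)
  have t: "0 < tpar n" using tpar_ge_2[OF assms] by simp
  show "{eps n..<1} = (\<Union>k\<in>{2..}. I_cyl n k [1])"
  proof (rule set_eqI)
    fix \<alpha>
    define g where "g = ((1 - \<alpha>) * tpar n + 1 / ((1 - \<alpha>) * tpar n) + 1) / tpar n"
    have "\<alpha> \<in> {eps n..<1} \<longleftrightarrow> 0 \<le> \<alpha> \<and> \<alpha> < 1 \<and> 2 \<le> g"
      using eps_bound_iff[OF assms, of \<alpha>] t by (auto simp: g_def pos_le_divide_eq)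
    also have "2 \<le> g \<longleftrightarrow> (\<exists>k\<ge>2. \<lfloor>g\<rfloor> = int k)"
    proof
      assume "2 \<le> g"
      then have "2 \<le> \<lfloor>g\<rfloor>" by (simp add: le_floor_iff)
      then have "2 \<le> nat \<lfloor>g\<rfloor>" "\<lfloor>g\<rfloor> = int (nat \<lfloor>g\<rfloor>)" by linarith+
      then show "\<exists>k\<ge>2. \<lfloor>g\<rfloor> = int k" by blast
    next
      assume "\<exists>k\<ge>2. \<lfloor>g\<rfloor> = int k"
      then obtain k where "2 \<le> k" "\<lfloor>g\<rfloor> = int k" by blast
      then have "2 \<le> \<lfloor>g\<rfloor>" by linarith
      then show "2 \<le> g" by (simp add: le_floor_iff)
    qed
    finally show "\<alpha> \<in> {eps n..<1} \<longleftrightarrow> \<alpha> \<in> (\<Union>k\<in>{2..}. I_cyl n k [1])"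
      using one_letter_cyl_iff[OF assms, of _ \<alpha>, folded g_def] by auto
  qed
  show "disjoint_family_on (\<lambda>k. I_cyl n k [1]) {2..}"
    unfolding disjoint_family_on_def
  proof (intro ballI impI equals0I)
    fix i j \<alpha> assume "i \<in> {2..}" "j \<in> {2..}" "i \<noteq> j" "\<alpha> \<in> I_cyl n i [1] \<inter> I_cyl n j [1]"
    then show False using one_letter_cyl_iff[OF assms, of i \<alpha>] one_letter_cyl_iff[OF assms, of j \<alpha>] by simp
  qed
next
  fix k :: nat and v assume k: "2 \<le> k" and v: "v \<in> Vwords"
  interpret expansion n k using assms k by unfold_locales
  show "I_cyl n k v = J_int n k v \<union> (\<Union>q\<in>Theta_index v. I_cyl n k (Theta q v))"
    by (rule I_cyl_partition(1)[OF v])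
  show "disjoint_family_on (\<lambda>q. I_cyl n k (Theta q v)) (Theta_index v)"
    by (rule I_cyl_partition(2)[OF v])
  show "J_int n k v \<inter> I_cyl n k (Theta q v) = {}" if "q \<in> Theta_index v" for q
    using I_cyl_partition(3)[OF v] that by blast
qed

end
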